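(* Assume that the marginal CDF $F$ of the nonconformity scores $V_t$ is continuous and that $\Theta=\sum_{k\ge0}\theta_k<\infty$. Then the following bounds hold. (i) If $\frac2n+\left(\frac{2\Theta^2}{n}\right)^{1/3}<\min\{\alpha,1-\alpha\}$, then $$\left|\mathbb P\{Y_{n+1}\in\widehat C_n(X_{n+1})\}-(1-\alpha)\right|\le \frac2n+3\left(\frac{\Theta^2}{4n}\right)^{1/3}.$$ (ii) Suppose additionally that, for some $e,c_f,L>0$, $F$ has a density $f$ with $f(v)\ge c_f$ on $[q-e,q+e]$, and the conditional distribution of $V_t$ given $\mathcal F_{t-1}=\sigma(\varepsilon_j:j\le t-1)$ has a density bounded by $L$ on $[q-e,q+e]$ almost surely. If $2/n\le c_fe/2$, then $$\left|\mathbb P\{Y_{n+1}\in\widehat C_n(X_{n+1})\}-(1-\alpha)\right|\le \frac{2L}{c_fn}+\frac{2\sqrt2\,L\,\Theta}{c_f\sqrt n}+\frac{8\Theta^2}{nc_f^2e^2}.$$ Both bounds hold at every deterministic future index $t>n$, that is, with $\mathbb P\{Y_t\in\widehat C_n(X_t)\}$ in place of $\mathbb P\{Y_{n+1}\in\widehat C_n(X_{n+1})\}$.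
   Context: Setup. $(\varepsilon_t)_{t\in\mathbb Z}$ are iid random innovations (possibly vector-valued). $Z_t=(X_t,Y_t)$, with $X_t\in\mathbb R^d$, $Y_t\in\mathbb R$, is a stationary process of the form $Z_t=G(\ldots,\varepsilon_{t-1},\varepsilon_t)$ with a measurable function $G$. The predictor $\widehat\mu:\mathbb R^d\to\mathbb R$ is a fixed (nonrandom) measurable function. The nonconformity scores are $V_t=|Y_t-\widehat\mu(X_t)|=H(\ldots,\varepsilon_{t-1},\varepsilon_t)$, with a measurable function $H$. $F(v)=\mathbb P(V_t\le v)$. Split conformal procedure. For $0<\alpha<1$ and $n\ge1$, let $k_n=\lceil(n+1)(1-\alpha)\rceil$, let $\widehat q_n=V_{(k_n)}$ be the $k_n$-th order statistic of the calibration scores $V_1,\ldots,V_n$ (with $\widehat q_n=\infty$ if $k_n>n$), and $\widehat C_n(x)=[\widehat\mu(x)-\widehat q_n,\widehat\mu(x)+\widehat q_n]$. Thus $Y_t\in\widehat C_n(X_t)$ iff $V_t\le\widehat q_n$. $q=F^{-1}(1-\alpha)=\inf\{v:F(v)\ge1-\alpha\}$. Functional dependence of threshold indicators. Let $\varepsilon_0'$ be an independent copy of $\varepsilon_0$, independent of all the innovations, and let $V_k^*$ be $V_k$ with $\varepsilon_0$ replaced by $\varepsilon_0'$, all other innovations unchanged. With $\|U\|_2=(\mathbb E|U|^2)^{1/2}$, $\theta_k=\sup_{v\in\mathbb R}\|\mathbf 1\{V_k\le v\}-\mathbf 1\{V_k^*\le v\}\|_2$ for $k\ge0$, and $\Theta=\sum_{k=0}^\infty\theta_k$.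 *)

theory Defs
  imports "HOL-Probability.Probability"
begin

text \<open>The past \<open>(\<dots>, \<epsilon>\<^sub>t\<^sub>-\<^sub>1, \<epsilon>\<^sub>t)\<close> is encoded as the sequence whose entry \<open>j\<close> is \<open>\<epsilon>\<^sub>t\<^sub>-\<^sub>j\<close>.\<close>

definition past :: "(int \<Rightarrow> 'w \<Rightarrow> 'e) \<Rightarrow> int \<Rightarrow> 'w \<Rightarrow> nat \<Rightarrow> 'e" where
  "past \<epsilon> t \<omega> = (\<lambda>j. \<epsilon> (t - int j) \<omega>)"

definition innovation_sigma ::
  "'w measure \<Rightarrow> 'e measure \<Rightarrow> (int \<Rightarrow> 'w \<Rightarrow> 'e) \<Rightarrow> int \<Rightarrow> 'w measure" where
  "innovation_sigma M S \<epsilon> t =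
     sigma (space M) (\<Union>j\<in>{..t}. {\<epsilon> j -` A \<inter> space M | A. A \<in> sets S})"

definition score :: "('x \<Rightarrow> real) \<Rightarrow> 'x \<times> real \<Rightarrow> real" where
  "score \<mu> = (\<lambda>(x, y). \<bar>y - \<mu> x\<bar>)"

definition L2_norm :: "'w measure \<Rightarrow> ('w \<Rightarrow> real) \<Rightarrow> real" where
  "L2_norm M U = sqrt (\<integral>\<omega>. \<bar>U \<omega>\<bar>\<^sup>2 \<partial>M)"

text \<open>The supremum below is over a set of reals in \<open>[0, 1]\<close> whenever \<open>M\<close> is a probability space.\<close>

definition indicator_dependence ::
  "'w measure \<Rightarrow> ('w \<Rightarrow> real) \<Rightarrow> ('w \<Rightarrow> real) \<Rightarrow> real" where
  "indicator_dependence M V V' =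
     (SUP v. L2_norm M (\<lambda>\<omega>. indicator {..v} (V \<omega>) - indicator {..v} (V' \<omega>)))"

definition lower_quantile :: "(real \<Rightarrow> real) \<Rightarrow> real \<Rightarrow> real" where
  "lower_quantile F p = Inf {v. F v \<ge> p}"

definition order_statistic :: "nat \<Rightarrow> real list \<Rightarrow> real" where
  "order_statistic k vs = sort vs ! (k - 1)"

definition conformal_rank :: "real \<Rightarrow> nat \<Rightarrow> nat" where
  "conformal_rank \<alpha> n = nat \<lceil>(real n + 1) * (1 - \<alpha>)\<rceil>"

definition conformal_quantile :: "real \<Rightarrow> nat \<Rightarrow> (int \<Rightarrow> real) \<Rightarrow> ereal" where
  "conformal_quantile \<alpha> n v =
     (if conformal_rank \<alpha> n > n then \<infinity>
      else ereal (order_statistic (conformal_rank \<alpha> n) (map v [1..int n])))"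

definition conformal_set :: "('x \<Rightarrow> real) \<Rightarrow> ereal \<Rightarrow> 'x \<Rightarrow> real set" where
  "conformal_set \<mu> r x = {y. ereal (\<mu> x) - r \<le> ereal y \<and> ereal y \<le> ereal (\<mu> x) + r}"

text \<open>\<open>K\<close> is a regular version of the conditional distribution of \<open>X\<close> given the
  sub-sigma-algebra \<open>\<F>\<close> of \<open>M\<close>.\<close>

definition regular_cond_distr ::
  "'w measure \<Rightarrow> 'w measure \<Rightarrow> 'b measure \<Rightarrow> ('w \<Rightarrow> 'b) \<Rightarrow> ('w \<Rightarrow> 'b measure) \<Rightarrow> bool" where
  "regular_cond_distr M \<F> N X K \<longleftrightarrow>
     K \<in> \<F> \<rightarrow>\<^sub>M prob_algebra N \<and>
     (\<forall>A\<in>sets N. AE \<omega> in M.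
        measure (K \<omega>) A = real_cond_exp M \<F> (indicator (X -` A \<inter> space M)) \<omega>)"

end

theory Submission
  imports Defs
begin

text \<open>
The prediction set covers \<open>Y t\<close> exactly when \<open>V t\<close> is at most the empirical quantile \<open>q\<^sub>n\<close>, and
\<open>q\<^sub>n \<le> c\<close> exactly when at least \<open>k\<close> of the calibration scores are at most \<open>c\<close>. So \<open>V t\<close> and \<open>q\<^sub>n\<close> can
be compared through the counts \<open>N c = card {i. V i \<le> c}\<close> at deterministic thresholds \<open>c\<close>, where
\<open>F c\<close> and \<open>k / n\<close> differ by a known amount. The only probabilistic input on the calibration scores is
the second-moment bound \<open>E (N c - n F c)\<^sup>2 \<le> n \<Theta>\<^sup>2\<close> (\<open>count_second_moment\<close>), for each fixed \<open>c\<close>.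

That bound is the Efron--Stein inequality. If \<open>E\<^sub>j\<close> averages out the innovation at time \<open>j\<close>, then
\<open>Var S \<le> \<Sum>j. \<parallel>S - E\<^sub>j S\<parallel>\<^sup>2\<close> for a function \<open>S\<close> of independent innovations. For \<open>S = N c\<close> the difference
\<open>S - E\<^sub>j S\<close> is a sum over \<open>i \<ge> j\<close> of terms of norm at most \<open>\<theta> (i - j)\<close>, since by Jensen averaging moves an
indicator by no more in \<open>L\<^sup>2\<close> than resampling does. By Minkowski
\<open>\<parallel>S - E\<^sub>j S\<parallel>\<^sup>2 \<le> (\<Sum>i. \<theta> (i - j))\<^sup>2 \<le> \<Theta> (\<Sum>i. \<theta> (i - j))\<close>, and the sum over \<open>j\<close> is at most \<open>n \<Theta>\<^sup>2\<close>. Because a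
score depends on the whole infinite past, the inequality is first proved for finitely many averaged
coordinates, with a remainder; the remainder vanishes in the limit, as in the zero-one law
(\<open>avgs_indicator_tendsto\<close>).

For a continuous \<open>F\<close>, take \<open>c\<close> with \<open>F c = k / n \<plusminus> \<delta>\<close>: Chebyshev's inequality costs \<open>\<Theta>\<^sup>2 / (n \<delta>\<^sup>2)\<close> on top
of \<open>\<delta>\<close>, and \<open>\<delta> = (2 \<Theta>\<^sup>2 / n)\<^bsup>1/3\<^esup>\<close> minimises the sum (\<open>coverage_continuous\<close>).

With densities, the coverage error is the difference \<open>P (q < V t \<le> q\<^sub>n) - P (q\<^sub>n < V t \<le> q)\<close>, hence at
most the larger of the two. If \<open>V t\<close> is in the first event and exceeds \<open>q + s\<close>, then \<open>q\<^sub>n > q + s\<close>.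
This is an event of the past whose probability Chebyshev bounds by a constant over \<open>s\<^sup>2\<close>, up to a
shift of \<open>s\<close> by the rounding error, and given the past \<open>V t\<close> falls into an interval of length \<open>l\<close>
with probability at most \<open>L l\<close>. Cutting the range of \<open>V t - q\<close> at points that
double in distance gives a geometric series (\<open>geometric_grid_bound\<close>), which replaces an integration
of tail probabilities (\<open>coverage_density\<close>).
\<close>

section \<open>Averaging out independent coordinates\<close>

lemma indicator_UN_lessThan:
  fixes A :: "nat \<Rightarrow> 'a set"
  assumes "disjoint_family A"
  shows "indicator (\<Union>i<N. A i) x = (\<Sum>i<N. indicator (A i) x :: real)"
proof (induction N)
  case (Suc N)
  have "(\<Union>i<N. A i) \<inter> A N = {}"
  proof (intro equals0I)
    fix y assume "y \<in> (\<Union>i<N. A i) \<inter> A N"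
    then obtain i where "i < N" "y \<in> A i \<inter> A N" by auto
    then show False using disjoint_family_onD[OF assms, of i N] by simp
  qed
  from indicator_disj_union[OF this, of x, where 'a=real] show ?case
    by (simp only: lessThan_Suc UN_insert Un_commute[of "A N"] Suc.IH)
      (simp add: add.commute)
qed simp

locale iid_coordinates = Q: prob_space Q for Q :: "'e measure" +
  fixes P :: "('i \<Rightarrow> 'e) measure"
  assumes P_eq: "P = Pi\<^sub>M UNIV (\<lambda>_. Q)"
begin

sublocale P: prob_space P
  unfolding P_eq by (intro prob_space_PiM Q.prob_space_axioms)

sublocale PQ: pair_prob_space P Q ..

sublocale QQ: pair_prob_space Q Q ..

lemma fun_upd_in_space [simp]:
  "x \<in> space P \<Longrightarrow> y \<in> space Q \<Longrightarrow> x(j := y) \<in> space P"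
  by (auto simp: P_eq space_PiM PiE_def)

lemma measurable_resample [measurable]: "(\<lambda>(x, y). x(j := y)) \<in> P \<Otimes>\<^sub>M Q \<rightarrow>\<^sub>M P"
  using measurable_add_dim[of j UNIV "\<lambda>_. Q"] by (simp add: P_eq)

lemma measurable_resample' [measurable]:
  assumes "f \<in> N \<rightarrow>\<^sub>M P" "g \<in> N \<rightarrow>\<^sub>M Q"
  shows "(\<lambda>x. (f x)(j := g x)) \<in> N \<rightarrow>\<^sub>M P"
  using measurable_compose[OF measurable_Pair[OF assms] measurable_resample] by simp

lemma distr_resample: "distr (Q \<Otimes>\<^sub>M P) P (\<lambda>(y, x). x(j := y)) = P"
  using distr_pair_PiM_eq_PiM[of UNIV "\<lambda>_. Q" j] Q.prob_space_axioms by (simp add: P_eq)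

text \<open>Averages of sums of indicators are all that is needed below, so every function is kept bounded. This
settles integrability once and for all; bounds are required on the space only, as values outside
it are arbitrary.\<close>

definition bounded_measurable :: "(('i \<Rightarrow> 'e) \<Rightarrow> real) \<Rightarrow> bool" where
  "bounded_measurable h \<longleftrightarrow> h \<in> borel_measurable P \<and> (\<exists>C. \<forall>x\<in>space P. \<bar>h x\<bar> \<le> C)"

lemma bounded_measurableI:
  "h \<in> borel_measurable P \<Longrightarrow> (\<And>x. x \<in> space P \<Longrightarrow> \<bar>h x\<bar> \<le> C) \<Longrightarrow> bounded_measurable h"
  by (auto simp: bounded_measurable_def)

lemma bounded_measurableD [measurable_dest]: "bounded_measurable h \<Longrightarrow> h \<in> borel_measurable P"
  by (simp add: bounded_measurable_def)

lemma bounded_measurable_const: "bounded_measurable (\<lambda>x. c)"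
  by (auto simp: bounded_measurable_def)

lemma bounded_measurable_diff:
  assumes "bounded_measurable h" "bounded_measurable g"
  shows "bounded_measurable (\<lambda>x. h x - g x)"
proof -
  obtain C D where "\<And>x. x \<in> space P \<Longrightarrow> \<bar>h x\<bar> \<le> C" "\<And>x. x \<in> space P \<Longrightarrow> \<bar>g x\<bar> \<le> D"
    using assms unfolding bounded_measurable_def by blast
  then have "\<bar>h x - g x\<bar> \<le> C + D" if "x \<in> space P" for x
    using that by fastforce
  then show ?thesis
    using assms by (intro bounded_measurableI[where C="C + D"]) (auto simp: bounded_measurable_def)
qed

lemma bounded_measurable_mult:
  assumes "bounded_measurable h" "bounded_measurable g"
  shows "bounded_measurable (\<lambda>x. h x * g x)"
proof -
  obtain C D where "\<And>x. x \<in> space P \<Longrightarrow> \<bar>h x\<bar> \<le> C" "\<And>x. x \<in> space P \<Longrightarrow> \<bar>g x\<bar> \<le> D"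
    using assms unfolding bounded_measurable_def by blast
  then have "\<bar>h x * g x\<bar> \<le> C * D" if "x \<in> space P" for x
    using that unfolding abs_mult by (meson abs_ge_zero mult_mono order_trans)
  then show ?thesis
    using assms by (intro bounded_measurableI[where C="C * D"]) (auto simp: bounded_measurable_def)
qed

lemma bounded_measurable_sum:
  assumes "\<And>d. d \<in> D \<Longrightarrow> bounded_measurable (h d)"
  shows "bounded_measurable (\<lambda>x. \<Sum>d\<in>D. h d x)"
proof -
  have "\<exists>C. \<forall>d\<in>D. \<forall>x\<in>space P. \<bar>h d x\<bar> \<le> C d"
    using assms unfolding bounded_measurable_def by (intro bchoice) auto
  then obtain C where "\<And>d x. d \<in> D \<Longrightarrow> x \<in> space P \<Longrightarrow> \<bar>h d x\<bar> \<le> C d" by blast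
  then have "\<bar>\<Sum>d\<in>D. h d x\<bar> \<le> (\<Sum>d\<in>D. C d)" if "x \<in> space P" for x
    using that by (intro order_trans[OF sum_abs] sum_mono) auto
  then show ?thesis
    using assms by (intro bounded_measurableI[where C="\<Sum>d\<in>D. C d"] borel_measurable_sum)
      (auto simp: bounded_measurable_def)
qed

lemma bounded_measurable_power2:
  "bounded_measurable h \<Longrightarrow> bounded_measurable (\<lambda>x. (h x)\<^sup>2)"
  unfolding power2_eq_square by (rule bounded_measurable_mult)

lemma bounded_measurable_abs: "bounded_measurable h \<Longrightarrow> bounded_measurable (\<lambda>x. \<bar>h x\<bar>)"
  by (auto simp: bounded_measurable_def)

lemma bounded_measurable_indicator:
  "A \<in> sets P \<Longrightarrow> bounded_measurable (indicator A)"
  by (auto simp: bounded_measurable_def indicator_def intro!: exI[of _ 1])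

lemmas bounded_measurable_intros =
  bounded_measurable_const bounded_measurable_diff bounded_measurable_mult bounded_measurable_sum
  bounded_measurable_power2 bounded_measurable_abs bounded_measurable_indicator

lemma integrable_bounded_measurable: "bounded_measurable h \<Longrightarrow> integrable P h"
  unfolding bounded_measurable_def by (auto intro!: P.integrable_const_bound AE_I2)

text \<open>The average over the \<open>j\<close>-th coordinate is the conditional expectation given all the others.\<close>

definition avg :: "'i \<Rightarrow> (('i \<Rightarrow> 'e) \<Rightarrow> real) \<Rightarrow> ('i \<Rightarrow> 'e) \<Rightarrow> real" where
  "avg j h x = (\<integral>y. h (x(j := y)) \<partial>Q)"

lemma integrable_resample:
  assumes "bounded_measurable h" "x \<in> space P"
  shows "integrable Q (\<lambda>y. h (x(j := y)))"
proof -
  obtain C where C: "\<And>x. x \<in> space P \<Longrightarrow> \<bar>h x\<bar> \<le> C"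
    using assms by (auto simp: bounded_measurable_def)
  have [measurable]: "h \<in> borel_measurable P" using assms by (rule_tac bounded_measurableD)
  show ?thesis
    using assms(2) by (intro Q.integrable_const_bound[where B=C] AE_I2) (auto intro!: C)
qed

lemma avg_bound:
  assumes "bounded_measurable h" "\<And>x. x \<in> space P \<Longrightarrow> \<bar>h x\<bar> \<le> C" "x \<in> space P"
  shows "\<bar>avg j h x\<bar> \<le> C"
proof -
  have "\<bar>avg j h x\<bar> \<le> (\<integral>y. \<bar>h (x(j := y))\<bar> \<partial>Q)"
    unfolding avg_def by (rule integral_abs_bound)
  also have "\<dots> \<le> C"
    using assms integrable_resample[OF assms(1,3)] by (intro Q.integral_le_const AE_I2) auto
  finally show ?thesis .
qed

lemma bounded_measurable_avg:
  assumes "bounded_measurable h"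
  shows "bounded_measurable (avg j h)"
proof -
  obtain C where C: "\<And>x. x \<in> space P \<Longrightarrow> \<bar>h x\<bar> \<le> C"
    using assms by (auto simp: bounded_measurable_def)
  have [measurable]: "h \<in> borel_measurable P" using assms by (rule bounded_measurableD)
  have "avg j h \<in> borel_measurable P" unfolding avg_def[abs_def] by measurable
  then show ?thesis using avg_bound[OF assms C] by (intro bounded_measurableI) auto
qed

lemma integral_resample:
  assumes "bounded_measurable h"
  shows "(\<integral>x. (\<integral>y. h (x(j := y)) \<partial>Q) \<partial>P) = (\<integral>x. h x \<partial>P)"
proof -
  obtain C where C: "\<And>x. x \<in> space P \<Longrightarrow> \<bar>h x\<bar> \<le> C"
    using assms by (auto simp: bounded_measurable_def)
  have [measurable]: "h \<in> borel_measurable P" using assms by (rule bounded_measurableD)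
  have int: "integrable (P \<Otimes>\<^sub>M Q) (\<lambda>(x, y). h (x(j := y)))"
    by (intro PQ.integrable_const_bound[where B=C] AE_I2)
      (auto intro!: C simp: space_pair_measure)
  have "(\<integral>x. h x \<partial>P) = (\<integral>z. h z \<partial>distr (Q \<Otimes>\<^sub>M P) P (\<lambda>(y, x). x(j := y)))"
    by (simp add: distr_resample)
  also have "\<dots> = (\<integral>(y, x). h (x(j := y)) \<partial>(Q \<Otimes>\<^sub>M P))"
    by (subst integral_distr) (auto simp: case_prod_unfold)
  also have "\<dots> = (\<integral>(x, y). h (x(j := y)) \<partial>(P \<Otimes>\<^sub>M Q))"
    by (subst PQ.integral_product_swap[symmetric]) (auto simp: case_prod_unfold)
  also have "\<dots> = (\<integral>x. (\<integral>y. h (x(j := y)) \<partial>Q) \<partial>P)"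
    using PQ.integral_fst[OF int] by simp
  finally show ?thesis ..
qed

lemma integral_avg: "bounded_measurable h \<Longrightarrow> (\<integral>x. avg j h x \<partial>P) = (\<integral>x. h x \<partial>P)"
  unfolding avg_def by (rule integral_resample)

text \<open>Averaging is an orthogonal projection of \<open>L\<^sup>2\<close>: it preserves integrals, and \<open>avg j h\<close> does
  not see the \<open>j\<close>-th coordinate, so that \<open>\<integral>h * avg j h = \<integral>(avg j h)\<^sup>2\<close>.\<close>

lemma avg_pythagoras:
  assumes h: "bounded_measurable h"
  shows "(\<integral>x. (h x)\<^sup>2 \<partial>P) = (\<integral>x. (avg j h x)\<^sup>2 \<partial>P) + (\<integral>x. (h x - avg j h x)\<^sup>2 \<partial>P)"
proof -
  note E = bounded_measurable_avg[OF h, of j]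
  note [simp] = integrable_bounded_measurable
  note [intro] = bounded_measurable_intros h E
  have "(\<integral>x. h x * avg j h x \<partial>P) = (\<integral>x. avg j (\<lambda>x. h x * avg j h x) x \<partial>P)"
    by (rule integral_avg[symmetric]) auto
  also have "\<dots> = (\<integral>x. (avg j h x)\<^sup>2 \<partial>P)"
    by (simp add: avg_def power2_eq_square)
  finally have cross: "(\<integral>x. h x * avg j h x \<partial>P) = (\<integral>x. (avg j h x)\<^sup>2 \<partial>P)" .
  have "(\<integral>x. (h x - avg j h x)\<^sup>2 \<partial>P) = (\<integral>x. (h x)\<^sup>2 - 2 * (h x * avg j h x) + (avg j h x)\<^sup>2 \<partial>P)"
    by (simp add: power2_diff algebra_simps)
  also have "\<dots> = (\<integral>x. (h x)\<^sup>2 \<partial>P) - 2 * (\<integral>x. h x * avg j h x \<partial>P) + (\<integral>x. (avg j h x)\<^sup>2 \<partial>P)"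
    using integrable_bounded_measurable[of "\<lambda>x. (h x)\<^sup>2"]
      integrable_bounded_measurable[of "\<lambda>x. h x * avg j h x"]
      integrable_bounded_measurable[of "\<lambda>x. (avg j h x)\<^sup>2"] by (simp add: h E bounded_measurable_intros)
  finally show ?thesis using cross by simp
qed

lemma integral_avg_power2_le:
  "bounded_measurable h \<Longrightarrow> (\<integral>x. (avg j h x)\<^sup>2 \<partial>P) \<le> (\<integral>x. (h x)\<^sup>2 \<partial>P)"
  by (simp add: avg_pythagoras[of h j])

lemma integral_avg_abs_le:
  assumes h: "bounded_measurable h"
  shows "(\<integral>x. \<bar>avg j h x\<bar> \<partial>P) \<le> (\<integral>x. \<bar>h x\<bar> \<partial>P)"
proof -
  have "(\<integral>x. \<bar>avg j h x\<bar> \<partial>P) \<le> (\<integral>x. avg j (\<lambda>x. \<bar>h x\<bar>) x \<partial>P)"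
    by (intro integral_mono integrable_bounded_measurable bounded_measurable_intros
        bounded_measurable_avg h) (auto simp: avg_def)
  also have "\<dots> = (\<integral>x. \<bar>h x\<bar> \<partial>P)"
    by (intro integral_avg bounded_measurable_intros h)
  finally show ?thesis .
qed

text \<open>Commutation is what lets \<open>h - avg j h\<close> be formed before, instead of after, the other coordinates are
averaged out; the increments of the martingale \<open>E (h | coordinates outside js)\<close> are then controlled by
single-coordinate quantities.\<close>

lemma avg_commute:
  assumes h: "bounded_measurable h" and x: "x \<in> space P"
  shows "avg i (avg j h) x = avg j (avg i h) x"
proof (cases "i = j")
  case False
  obtain C where C: "\<And>x. x \<in> space P \<Longrightarrow> \<bar>h x\<bar> \<le> C"
    using h by (auto simp: bounded_measurable_def)
  have [measurable]: "h \<in> borel_measurable P" using h by (rule bounded_measurableD)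
  have [simp]: "x \<in> space P" by fact
  have "(\<integral>y. (\<integral>y'. h (x(i := y, j := y')) \<partial>Q) \<partial>Q) = (\<integral>y'. (\<integral>y. h (x(i := y, j := y')) \<partial>Q) \<partial>Q)"
    by (intro QQ.Fubini_integral[symmetric] QQ.integrable_const_bound[where B=C] AE_I2)
      (auto intro!: C simp: space_pair_measure)
  then show ?thesis
    using False by (simp add: avg_def fun_upd_twist)
qed simp

lemma avg_cong: "(\<And>x. x \<in> space P \<Longrightarrow> h x = g x) \<Longrightarrow> x \<in> space P \<Longrightarrow> avg j h x = avg j g x"
  unfolding avg_def by (intro Bochner_Integration.integral_cong) auto

lemma avg_diff:
  assumes "bounded_measurable h" "bounded_measurable g" "x \<in> space P"
  shows "avg j (\<lambda>x. h x - g x) x = avg j h x - avg j g x"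
  unfolding avg_def using assms
  by (intro Bochner_Integration.integral_diff integrable_resample)

lemma avg_sum:
  assumes "\<And>d. d \<in> D \<Longrightarrow> bounded_measurable (h d)" "x \<in> space P"
  shows "avg j (\<lambda>x. \<Sum>d\<in>D. h d x) x = (\<Sum>d\<in>D. avg j (h d) x)"
  unfolding avg_def using assms
  by (intro Bochner_Integration.integral_sum integrable_resample)

lemma avg_const [simp]: "avg j (\<lambda>x. c) x = c"
  by (simp add: avg_def Q.prob_space)

abbreviation avgs :: "'i list \<Rightarrow> (('i \<Rightarrow> 'e) \<Rightarrow> real) \<Rightarrow> ('i \<Rightarrow> 'e) \<Rightarrow> real" where
  "avgs js h \<equiv> foldr avg js h"

lemma bounded_measurable_avgs: "bounded_measurable h \<Longrightarrow> bounded_measurable (avgs js h)"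
  by (induction js) (auto intro: bounded_measurable_avg)

lemma avgs_bound:
  assumes "bounded_measurable h" "\<And>x. x \<in> space P \<Longrightarrow> \<bar>h x\<bar> \<le> C" "x \<in> space P"
  shows "\<bar>avgs js h x\<bar> \<le> C"
  using assms(3)
  by (induction js arbitrary: x) (auto intro!: avg_bound bounded_measurable_avgs assms(1,2))

lemma integral_avgs: "bounded_measurable h \<Longrightarrow> (\<integral>x. avgs js h x \<partial>P) = (\<integral>x. h x \<partial>P)"
  by (induction js) (auto simp: integral_avg bounded_measurable_avgs)

lemma integral_avgs_power2_le:
  "bounded_measurable h \<Longrightarrow> (\<integral>x. (avgs js h x)\<^sup>2 \<partial>P) \<le> (\<integral>x. (h x)\<^sup>2 \<partial>P)"
proof (induction js)
  case (Cons j js)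
  then show ?case
    using integral_avg_power2_le[OF bounded_measurable_avgs[OF Cons.prems, of js], of j] by simp
qed simp

lemma integral_avgs_abs_le:
  "bounded_measurable h \<Longrightarrow> (\<integral>x. \<bar>avgs js h x\<bar> \<partial>P) \<le> (\<integral>x. \<bar>h x\<bar> \<partial>P)"
proof (induction js)
  case (Cons j js)
  then show ?case
    using integral_avg_abs_le[OF bounded_measurable_avgs[OF Cons.prems, of js], of j] by simp
qed simp

lemma avgs_const [simp]: "avgs js (\<lambda>x. c) x = c"
proof -
  have "avgs js (\<lambda>x. c) = (\<lambda>x. c)"
  proof (induction js)
    case (Cons j js)
    have "avg j (\<lambda>x. c) = (\<lambda>x. c)" by (intro ext) simp
    with Cons show ?case by simp
  qed (simp)
  then show ?thesis by simp
qed

lemma avgs_diff: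
  assumes "bounded_measurable h" "bounded_measurable g" "x \<in> space P"
  shows "avgs js (\<lambda>x. h x - g x) x = avgs js h x - avgs js g x"
  using assms(3)
proof (induction js arbitrary: x)
  case (Cons j js)
  have "avg j (avgs js (\<lambda>x. h x - g x)) x = avg j (\<lambda>x. avgs js h x - avgs js g x) x"
    using Cons by (intro avg_cong) auto
  also have "\<dots> = avg j (avgs js h) x - avg j (avgs js g) x"
    using Cons.prems assms by (intro avg_diff bounded_measurable_avgs)
  finally show ?case by simp
qed simp

lemma avgs_sum:
  assumes "\<And>d. d \<in> D \<Longrightarrow> bounded_measurable (h d)" "x \<in> space P"
  shows "avgs js (\<lambda>x. \<Sum>d\<in>D. h d x) x = (\<Sum>d\<in>D. avgs js (h d) x)"
  using assms(2)
proof (induction js arbitrary: x)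
  case (Cons j js)
  have "avg j (avgs js (\<lambda>x. \<Sum>d\<in>D. h d x)) x = avg j (\<lambda>x. \<Sum>d\<in>D. avgs js (h d) x) x"
    using Cons by (intro avg_cong) auto
  also have "\<dots> = (\<Sum>d\<in>D. avg j (avgs js (h d)) x)"
    using Cons.prems assms by (intro avg_sum bounded_measurable_avgs)
  finally show ?case by simp
qed simp

lemma avg_avgs_commute:
  assumes h: "bounded_measurable h" and x: "x \<in> space P"
  shows "avg j (avgs js h) x = avgs js (avg j h) x"
  using x
proof (induction js arbitrary: x)
  case (Cons i js)
  have "avg j (avgs (i # js) h) x = avg i (avg j (avgs js h)) x"
    using Cons.prems h by (simp add: avg_commute bounded_measurable_avgs)
  also have "\<dots> = avg i (avgs js (avg j h)) x"
    using Cons by (intro avg_cong) auto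
  finally show ?case by simp
qed simp

lemma avgs_cong:
  assumes "\<And>x. x \<in> space P \<Longrightarrow> h x = g x" "x \<in> space P"
  shows "avgs js h x = avgs js g x"
  using assms(2)
proof (induction js arbitrary: x)
  case (Cons j js)
  then show ?case using avg_cong[of "avgs js h" "avgs js g" x j] by simp
qed (simp add: assms)

text \<open>Each further averaging loses, by Pythagoras, the squared norm of
\<open>avgs js h - avg j (avgs js h) = avgs js (h - avg j h)\<close>, and \<open>avgs js\<close> is a contraction. For centred \<open>h\<close> the
first summand is the part of the variance that the coordinates outside \<open>js\<close> explain by themselves; it
is zero if \<open>h\<close> depends on coordinates in \<open>js\<close> only.\<close>

lemma efron_stein_remainder:
  assumes h: "bounded_measurable h"
  shows "(\<integral>x. (h x)\<^sup>2 \<partial>P)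
    \<le> (\<integral>x. (avgs js h x)\<^sup>2 \<partial>P) + (\<Sum>j\<leftarrow>js. \<integral>x. (h x - avg j h x)\<^sup>2 \<partial>P)"
proof (induction js)
  case (Cons j js)
  note hs = bounded_measurable_avgs[OF h, of js]
  have "(\<integral>x. (avgs js h x - avg j (avgs js h) x)\<^sup>2 \<partial>P)
      = (\<integral>x. (avgs js (\<lambda>x. h x - avg j h x) x)\<^sup>2 \<partial>P)"
    using h by (intro Bochner_Integration.integral_cong)
      (auto simp: avgs_diff avg_avgs_commute bounded_measurable_avg)
  also have "\<dots> \<le> (\<integral>x. (h x - avg j h x)\<^sup>2 \<partial>P)"
    by (intro integral_avgs_power2_le bounded_measurable_intros bounded_measurable_avg h)
  finally show ?case
    using Cons avg_pythagoras[OF hs, of j] by simp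
qed simp

lemma avgs_local:
  assumes "\<And>x y. x \<in> space P \<Longrightarrow> y \<in> space P \<Longrightarrow> (\<And>i. i \<in> K \<Longrightarrow> x i = y i) \<Longrightarrow> h x = h y"
    and "x \<in> space P" "y \<in> space P" "\<And>i. i \<in> K - set js \<Longrightarrow> x i = y i"
  shows "avgs js h x = avgs js h y"
  using assms(2-)
proof (induction js arbitrary: x y)
  case (Cons j js)
  have "avg j (avgs js h) x = avg j (avgs js h) y"
    unfolding avg_def[of j "avgs js h"]
    using Cons.prems
    by (intro Bochner_Integration.integral_cong refl Cons.IH fun_upd_in_space) auto
  then show ?case by simp
qed (auto intro: assms(1))

text \<open>Once every coordinate on which \<open>h\<close> depends has been averaged out, a constant remains, which can only
be the integral because averaging preserves integrals.\<close>

lemma avgs_local_const: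
  assumes h: "bounded_measurable h"
    and "\<And>x y. x \<in> space P \<Longrightarrow> y \<in> space P \<Longrightarrow> (\<And>i. i \<in> K \<Longrightarrow> x i = y i) \<Longrightarrow> h x = h y"
    and "K \<subseteq> set js" "x \<in> space P"
  shows "avgs js h x = (\<integral>x. h x \<partial>P)"
proof -
  have "(\<integral>y. h y \<partial>P) = (\<integral>y. avgs js h y \<partial>P)"
    using integral_avgs[OF h] by simp
  also have "\<dots> = (\<integral>y. avgs js h x \<partial>P)"
  proof (rule Bochner_Integration.integral_cong[OF refl])
    fix y assume "y \<in> space P"
    then show "avgs js h y = avgs js h x"
      using assms(3,4) by (intro avgs_local[where K=K, OF assms(2)]) auto
  qed
  finally show ?thesis by (simp add: P.prob_space)
qed

text \<open>Averaging out more and more coordinates makes an indicator constant in the limit, a quantitative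
Kolmogorov zero-one law. It holds trivially for cylinder sets, and the contraction property in \<open>L\<^sup>1\<close>
carries it to complements and disjoint unions, so Dynkin's \<open>\<pi>\<close>-\<open>\<lambda>\<close> argument gives all measurable sets.
\<open>L\<^sup>1\<close> is used because the tail of a disjoint union is small there by countable additivity.\<close>

lemma avgs_indicator_tendsto:
  assumes "A \<in> sets P" "\<delta> > 0"
  shows "\<exists>J. finite J \<and> (\<forall>js. J \<subseteq> set js \<longrightarrow>
    (\<integral>x. \<bar>avgs js (indicator A) x - P.prob A\<bar> \<partial>P) < \<delta>)"
proof -
  have "A \<in> sigma_sets (\<Pi>\<^sub>E i\<in>UNIV. space Q) (prod_algebra UNIV (\<lambda>_. Q))"
    using assms(1) by (simp add: P_eq sets_PiM)
  then show ?thesis using assms(2)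
  proof (induction A arbitrary: \<delta>
      rule: sigma_sets_induct_disjoint[OF Int_stable_prod_algebra prod_algebra_sets_into_space,
        consumes 1, case_names basic empty compl union])
    case (basic A)
    have A: "A \<in> sets P" using basic by (simp add: P_eq sets_PiM)
    from basic(1) show ?case
    proof (rule prod_algebraE)
      fix J E assume J: "A = prod_emb UNIV (\<lambda>_. Q) J (Pi\<^sub>E J E)" "finite J"
      have local: "indicator A x = (indicator A y :: real)"
        if "x \<in> space P" "y \<in> space P" "\<And>i. i \<in> J \<Longrightarrow> x i = y i" for x y
        using that by (auto simp: J(1) indicator_def prod_emb_def P_eq space_PiM PiE_iff)
      have "avgs js (indicator A) x = P.prob A" if "J \<subseteq> set js" "x \<in> space P" for js x
      proof -
        have "avgs js (indicator A) x = (\<integral>x. indicator A x \<partial>P)"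
          by (rule avgs_local_const[OF _ local]) (use that A bounded_measurable_indicator in auto)
        then show ?thesis using A by simp
      qed
      then have "(\<integral>x. \<bar>avgs js (indicator A) x - P.prob A\<bar> \<partial>P) = (\<integral>x. 0 \<partial>P)" if "J \<subseteq> set js" for js
        using that by (intro Bochner_Integration.integral_cong) auto
      then show ?thesis using J(2) basic by auto
    qed
  next
    case empty
    have "avgs js (indicator {}) x = 0" for js x
      using avgs_const[of js 0 x] by (simp add: indicator_def[abs_def])
    then show ?case using empty by (intro exI[of _ "{}"]) auto
  next
    case (compl A)
    have A: "A \<in> sets P" using compl by (simp add: P_eq sets_PiM)
    have sp: "(\<Pi>\<^sub>E i\<in>UNIV. space Q) = space P" by (simp add: P_eq space_PiM)
    have "avgs js (indicator (space P - A)) x = 1 - avgs js (indicator A) x" if "x \<in> space P" for js x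
    proof -
      have "avgs js (indicator (space P - A)) x = avgs js (\<lambda>x. 1 - indicator A x) x"
        using that by (intro avgs_cong) (auto simp: indicator_def)
      then show ?thesis using that A
        by (simp add: avgs_diff bounded_measurable_const bounded_measurable_indicator)
    qed
    then have "(\<integral>x. \<bar>avgs js (indicator (space P - A)) x - P.prob (space P - A)\<bar> \<partial>P)
        = (\<integral>x. \<bar>avgs js (indicator A) x - P.prob A\<bar> \<partial>P)" for js
      using P.prob_compl[OF A] by (intro Bochner_Integration.integral_cong) auto
    then show ?case using compl(2)[OF compl(3)] by (simp add: sp)
  next
    case (union A)
    have A: "A i \<in> sets P" for i using union by (auto simp: P_eq sets_PiM)
    let ?U = "\<Union>i. A i"
    have "(\<lambda>N. \<Sum>i<N. P.prob (A i)) \<longlonglongrightarrow> P.prob ?U"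
      using P.finite_measure_UNION[of A] A union(1) by (simp add: sums_def image_subset_iff)
    then have "\<exists>N. \<forall>m\<ge>N. norm ((\<Sum>i<m. P.prob (A i)) - P.prob ?U) < \<delta> / 4"
      using union(4) by (intro LIMSEQ_D) auto
    then obtain N where N: "\<bar>(\<Sum>i<N. P.prob (A i)) - P.prob ?U\<bar> < \<delta> / 4"
      by auto
    have "\<exists>J. \<forall>i\<in>{..<N}. finite (J i) \<and> (\<forall>js. J i \<subseteq> set js \<longrightarrow>
        (\<integral>x. \<bar>avgs js (indicator (A i)) x - P.prob (A i)\<bar> \<partial>P) < \<delta> / (2 * (real N + 1)))"
      using union(3)[of "\<delta> / (2 * (real N + 1))"] union(4) by (intro bchoice ballI) auto
    then obtain J where "\<forall>i\<in>{..<N}. finite (J i) \<and> (\<forall>js. J i \<subseteq> set js \<longrightarrow>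
        (\<integral>x. \<bar>avgs js (indicator (A i)) x - P.prob (A i)\<bar> \<partial>P) < \<delta> / (2 * (real N + 1)))"
      by (rule exE)
    then have J: "\<And>i. i < N \<Longrightarrow> finite (J i)" and
      conv: "\<And>i js. i < N \<Longrightarrow> J i \<subseteq> set js \<Longrightarrow>
        (\<integral>x. \<bar>avgs js (indicator (A i)) x - P.prob (A i)\<bar> \<partial>P) < \<delta> / (2 * (real N + 1))"
      by (blast, blast)
    \<comment> \<open>All but finitely many \<open>A i\<close> are put into \<open>r\<close>, which is small in \<open>L\<^sup>1\<close> before averaging and so
      also after averaging, whatever \<open>js\<close> is.\<close>
    define r :: "('i \<Rightarrow> 'e) \<Rightarrow> real"
      where "r x = indicator ?U x - (\<Sum>i<N. indicator (A i) x)" for x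
    have r_eq: "r x = indicator (?U - (\<Union>i<N. A i)) x" for x
      unfolding r_def indicator_UN_lessThan[OF union(1), symmetric]
      by (auto simp: indicator_def)
    have U: "?U \<in> sets P" using A by auto
    have bm: "bounded_measurable r" "\<And>i. bounded_measurable (indicator (A i))"
       "bounded_measurable (indicator ?U)"
      unfolding r_def[abs_def] by (intro bounded_measurable_intros A U)+
    have "(\<integral>x. \<bar>r x\<bar> \<partial>P) = (\<integral>x. r x \<partial>P)"
      by (intro Bochner_Integration.integral_cong) (auto simp: r_eq)
    also have "\<dots> = P.prob ?U - (\<Sum>i<N. P.prob (A i))"
      unfolding r_def using A U by (simp add: integrable_bounded_measurable bm)
    finally have r_small: "(\<integral>x. \<bar>r x\<bar> \<partial>P) < \<delta> / 4" using N by linarith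
    have "(\<integral>x. \<bar>avgs js (indicator ?U) x - P.prob ?U\<bar> \<partial>P) < \<delta>"
      if js: "(\<Union>i<N. J i) \<subseteq> set js" for js
    proof -
      define err where "err i x = \<bar>avgs js (indicator (A i)) x - P.prob (A i)\<bar>" for i x
      have int_err: "integrable P (err i)" for i
        unfolding err_def[abs_def]
        by (intro integrable_bounded_measurable bounded_measurable_intros bounded_measurable_avgs A)
      have int_r: "integrable P (\<lambda>x. \<bar>avgs js r x\<bar>)"
        by (intro integrable_bounded_measurable bounded_measurable_intros bounded_measurable_avgs bm)
      have split: "avgs js (indicator ?U) x
          = avgs js r x + (\<Sum>i<N. avgs js (indicator (A i)) x)" if x: "x \<in> space P" for x
      proof -
        have "avgs js r x = avgs js (indicator ?U) x - avgs js (\<lambda>x. \<Sum>i<N. indicator (A i) x) x"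
          unfolding r_def[abs_def] by (intro avgs_diff bounded_measurable_sum bm x)
        then show ?thesis using avgs_sum[of "{..<N}" "\<lambda>i. indicator (A i)" x js, OF bm(2) x] by simp
      qed
      have "(\<integral>x. \<bar>avgs js (indicator ?U) x - P.prob ?U\<bar> \<partial>P)
        \<le> (\<integral>x. \<bar>avgs js r x\<bar> + ((\<Sum>i<N. err i x) + \<delta> / 4) \<partial>P)"
      proof (rule integral_mono)
        fix x assume x: "x \<in> space P"
        have "\<bar>\<Sum>i<N. avgs js (indicator (A i)) x - P.prob (A i)\<bar> \<le> (\<Sum>i<N. err i x)"
          unfolding err_def by (rule sum_abs)
        then show "\<bar>avgs js (indicator ?U) x - P.prob ?U\<bar>
            \<le> \<bar>avgs js r x\<bar> + ((\<Sum>i<N. err i x) + \<delta> / 4)"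
          using N unfolding split[OF x] sum_subtractf by linarith
      next
        show "integrable P (\<lambda>x. \<bar>avgs js (indicator ?U) x - P.prob ?U\<bar>)"
          by (intro integrable_bounded_measurable bounded_measurable_intros bounded_measurable_avgs U)
        show "integrable P (\<lambda>x. \<bar>avgs js r x\<bar> + ((\<Sum>i<N. err i x) + \<delta> / 4))"
          by (intro Bochner_Integration.integrable_add Bochner_Integration.integrable_sum
              int_err int_r P.integrable_const)
      qed
      also have "\<dots> = (\<integral>x. \<bar>avgs js r x\<bar> \<partial>P) + ((\<Sum>i<N. \<integral>x. err i x \<partial>P) + \<delta> / 4)"
        using int_err int_r by (simp add: P.prob_space)
      also have "\<dots> \<le> (\<integral>x. \<bar>r x\<bar> \<partial>P) + ((\<Sum>i<N. \<delta> / (2 * (real N + 1))) + \<delta> / 4)"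
      proof (intro add_mono integral_avgs_abs_le sum_mono bm order_refl)
        fix i assume "i \<in> {..<N}"
        then show "(\<integral>x. err i x \<partial>P) \<le> \<delta> / (2 * (real N + 1))"
          unfolding err_def using js by (intro less_imp_le[OF conv]) auto
      qed
      also have "\<dots> < \<delta> / 4 + (\<delta> / 2 + \<delta> / 4)"
      proof -
        have "(\<Sum>i<N. \<delta> / (2 * (real N + 1))) \<le> \<delta> / 2"
          using union(4) by (simp add: field_simps)
        then show ?thesis using r_small by linarith
      qed
      finally show ?thesis by simp
    qed
    then show ?case using J by (intro exI[of _ "\<Union>i<N. J i"]) auto
  qed
qed

text \<open>For a finite sum of indicators the remainder is negligible: the sum is bounded, so that the \<open>L\<^sup>2\<close>
distance of its average from the mean is controlled by the \<open>L\<^sup>1\<close> distances of the single indicators.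
The hypothesis on all finite \<open>J\<close> stands for convergence of the series over all coordinates.\<close>

proposition efron_stein:
  fixes A :: "'d \<Rightarrow> ('i \<Rightarrow> 'e) set"
  assumes D: "finite D" and A: "\<And>d. d \<in> D \<Longrightarrow> A d \<in> sets P"
  defines "S \<equiv> (\<lambda>x. \<Sum>d\<in>D. indicator (A d) x :: real)"
  assumes bound: "\<And>J. finite J \<Longrightarrow> (\<Sum>j\<in>J. \<integral>x. (S x - avg j S x)\<^sup>2 \<partial>P) \<le> K"
  shows "(\<integral>x. (S x - (\<Sum>d\<in>D. P.prob (A d)))\<^sup>2 \<partial>P) \<le> K"
proof (rule field_le_epsilon)
  fix \<delta> :: real assume \<delta>: "\<delta> > 0"
  define c where "c = (\<Sum>d\<in>D. P.prob (A d))"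
  define N where "N = real (card D)"
  \<comment> \<open>With all \<open>L\<^sup>1\<close> errors below \<open>\<delta>'\<close>, the remainder is at most \<open>N\<^sup>2 \<delta>' \<le> \<delta>\<close>; the \<open>1\<close> covers \<open>N = 0\<close>.\<close>
  define \<delta>' where "\<delta>' = \<delta> / (N\<^sup>2 + 1)"
  have N0: "N \<ge> 0" by (simp add: N_def)
  have N1: "N\<^sup>2 + 1 > 0" by (simp add: add_nonneg_pos)
  have \<delta>': "\<delta>' > 0" using \<delta> N1 by (simp add: \<delta>'_def)
  have "\<exists>J. \<forall>d\<in>D. finite (J d) \<and> (\<forall>js. J d \<subseteq> set js \<longrightarrow>
      (\<integral>x. \<bar>avgs js (indicator (A d)) x - P.prob (A d)\<bar> \<partial>P) < \<delta>')"
    using avgs_indicator_tendsto[OF A \<delta>'] by (intro bchoice ballI)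
  then obtain J where J: "\<forall>d\<in>D. finite (J d) \<and> (\<forall>js. J d \<subseteq> set js \<longrightarrow>
      (\<integral>x. \<bar>avgs js (indicator (A d)) x - P.prob (A d)\<bar> \<partial>P) < \<delta>')"
    by (rule exE)
  have "finite (\<Union>d\<in>D. J d)" using D J by blast
  then obtain js where js: "set js = (\<Union>d\<in>D. J d)" "distinct js"
    using finite_distinct_list by blast
  have ind: "bounded_measurable (indicator (A d))" if "d \<in> D" for d
    using that by (intro bounded_measurable_indicator A)
  have S: "bounded_measurable S"
    unfolding S_def by (intro bounded_measurable_sum ind)
  define h where "h x = S x - c" for x
  have h: "bounded_measurable h"
    unfolding h_def[abs_def] by (intro bounded_measurable_intros S)
  define err where "err d x = \<bar>avgs js (indicator (A d)) x - P.prob (A d)\<bar>" for d x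
  have int_err: "integrable P (err d)" if "d \<in> D" for d
    unfolding err_def[abs_def] using that
    by (intro integrable_bounded_measurable bounded_measurable_intros bounded_measurable_avgs A)
  have err_le_1: "err d x \<le> 1" if "d \<in> D" "x \<in> space P" for d x
  proof -
    have "err d x = \<bar>avgs js (\<lambda>x. indicator (A d) x - P.prob (A d)) x\<bar>"
      unfolding err_def using that
      by (subst avgs_diff) (auto intro: ind bounded_measurable_const)
    also have "\<dots> \<le> 1"
    proof (rule avgs_bound[OF _ _ that(2)])
      show "\<bar>indicator (A d) x - P.prob (A d)\<bar> \<le> 1" for x
        using P.prob_le_1[of "A d"] by (auto simp: indicator_def)
    qed (intro bounded_measurable_diff bounded_measurable_const ind that)
    finally show ?thesis .
  qed
  have sq: "(avgs js h x)\<^sup>2 \<le> N * (\<Sum>d\<in>D. err d x)" if x: "x \<in> space P" for x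
  proof -
    have "avgs js h x = avgs js S x - c"
      unfolding h_def[abs_def] using x by (subst avgs_diff) (auto intro: S bounded_measurable_const)
    also have "avgs js S x = (\<Sum>d\<in>D. avgs js (indicator (A d)) x)"
      unfolding S_def using x by (intro avgs_sum ind)
    finally have eq: "avgs js h x = (\<Sum>d\<in>D. avgs js (indicator (A d)) x - P.prob (A d))"
      by (simp add: c_def sum_subtractf)
    have le: "\<bar>avgs js h x\<bar> \<le> (\<Sum>d\<in>D. err d x)"
      unfolding eq err_def by (rule sum_abs)
    have "(\<Sum>d\<in>D. err d x) \<le> N"
      using sum_bounded_above[of D "\<lambda>d. err d x" 1] err_le_1 x by (simp add: N_def)
    then have "\<bar>avgs js h x\<bar> * \<bar>avgs js h x\<bar> \<le> N * (\<Sum>d\<in>D. err d x)"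
      using le by (intro mult_mono N0) auto
    then show ?thesis by (simp add: power2_eq_square)
  qed
  have "(\<integral>x. (avgs js h x)\<^sup>2 \<partial>P) \<le> (\<integral>x. N * (\<Sum>d\<in>D. err d x) \<partial>P)"
  proof (rule integral_mono[OF _ _ sq])
    show "integrable P (\<lambda>x. (avgs js h x)\<^sup>2)"
      by (intro integrable_bounded_measurable bounded_measurable_power2 bounded_measurable_avgs h)
    show "integrable P (\<lambda>x. N * (\<Sum>d\<in>D. err d x))"
      by (intro integrable_mult_right Bochner_Integration.integrable_sum int_err)
  qed
  also have "\<dots> = N * (\<Sum>d\<in>D. \<integral>x. err d x \<partial>P)"
    using int_err by simp
  also have "\<dots> \<le> N * (\<Sum>d\<in>D. \<delta>')"
  proof (intro mult_left_mono sum_mono N0)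
    fix d assume "d \<in> D"
    then show "(\<integral>x. err d x \<partial>P) \<le> \<delta>'"
      using J js(1) unfolding err_def by (intro less_imp_le) blast
  qed
  also have "\<dots> = \<delta> * (N\<^sup>2 / (N\<^sup>2 + 1))"
    by (simp add: N_def \<delta>'_def power2_eq_square)
  also have "\<dots> \<le> \<delta>"
    using \<delta> N1 by (intro mult_left_le) (auto simp: divide_le_eq)
  finally have rem: "(\<integral>x. (avgs js h x)\<^sup>2 \<partial>P) \<le> \<delta>" .
  have "(\<Sum>j\<leftarrow>js. \<integral>x. (h x - avg j h x)\<^sup>2 \<partial>P) = (\<Sum>j\<in>set js. \<integral>x. (h x - avg j h x)\<^sup>2 \<partial>P)"
    using js(2) by (simp add: sum_list_distinct_conv_sum_set)
  also have "\<dots> = (\<Sum>j\<in>set js. \<integral>x. (S x - avg j S x)\<^sup>2 \<partial>P)"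
  proof (intro sum.cong refl Bochner_Integration.integral_cong)
    fix j x assume x: "x \<in> space P"
    have "avg j h x = avg j S x - c"
      unfolding h_def[abs_def] using x by (subst avg_diff) (auto intro: S bounded_measurable_const)
    then show "(h x - avg j h x)\<^sup>2 = (S x - avg j S x)\<^sup>2"
      by (simp add: h_def)
  qed
  also have "\<dots> \<le> K" by (intro bound) simp
  finally have "(\<integral>x. (h x)\<^sup>2 \<partial>P) \<le> \<delta> + K"
    using efron_stein_remainder[OF h, of js] rem by linarith
  then show "(\<integral>x. (S x - (\<Sum>d\<in>D. P.prob (A d)))\<^sup>2 \<partial>P) \<le> K + \<delta>"
    by (simp add: h_def c_def)
qed

text \<open>The Cauchy--Schwarz inequality. Upper bounds \<open>a\<close> and \<open>b\<close> replace the norms, so that dependence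
coefficients can be inserted directly. For positive bounds the proof integrates
\<open>(b f - a g)\<^sup>2 \<ge> 0\<close>.\<close>

lemma integral_mult_le:
  assumes f: "bounded_measurable f" and g: "bounded_measurable g"
    and "(\<integral>x. (f x)\<^sup>2 \<partial>P) \<le> a\<^sup>2" "(\<integral>x. (g x)\<^sup>2 \<partial>P) \<le> b\<^sup>2" "a \<ge> 0" "b \<ge> 0"
  shows "(\<integral>x. f x * g x \<partial>P) \<le> a * b"
proof -
  note int = integrable_bounded_measurable
  have zero: "(\<integral>x. f x * g x \<partial>P) = 0"
    if "(\<integral>x. (f x)\<^sup>2 \<partial>P) \<le> 0" "bounded_measurable f" for f g
  proof -
    have "(\<integral>x. (f x)\<^sup>2 \<partial>P) = 0"
      using that(1) by (intro antisym) auto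
    then have "AE x in P. (f x)\<^sup>2 = 0"
      using integral_nonneg_eq_0_iff_AE[OF int[OF bounded_measurable_power2[OF that(2)]]] by simp
    then have "AE x in P. f x * g x = 0" by eventually_elim simp
    then show ?thesis by (rule integral_eq_zero_AE)
  qed
  consider "a = 0" | "b = 0" | "a > 0" "b > 0" using assms by linarith
  then show ?thesis
  proof cases
    case 1
    then show ?thesis using zero[of f g] assms by simp
  next
    case 2
    then show ?thesis using zero[of g f] assms by (simp add: mult.commute)
  next
    case 3
    have "(\<integral>x. f x * g x \<partial>P) \<le> (\<integral>x. b / (2 * a) * (f x)\<^sup>2 + a / (2 * b) * (g x)\<^sup>2 \<partial>P)"
    proof (rule integral_mono)
      fix x
      have "0 \<le> (b * f x - a * g x)\<^sup>2 / (2 * a * b)" using 3 by simp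
      also have "\<dots> = b / (2 * a) * (f x)\<^sup>2 + a / (2 * b) * (g x)\<^sup>2 - f x * g x"
        using 3 by (simp add: field_simps power2_eq_square)
      finally show "f x * g x \<le> b / (2 * a) * (f x)\<^sup>2 + a / (2 * b) * (g x)\<^sup>2" by simp
    qed (intro Bochner_Integration.integrable_add integrable_mult_right int
        bounded_measurable_intros f g)+
    also have "\<dots> = b / (2 * a) * (\<integral>x. (f x)\<^sup>2 \<partial>P) + a / (2 * b) * (\<integral>x. (g x)\<^sup>2 \<partial>P)"
      using int[OF bounded_measurable_power2[OF f]] int[OF bounded_measurable_power2[OF g]] by simp
    also have "\<dots> \<le> b / (2 * a) * a\<^sup>2 + a / (2 * b) * b\<^sup>2"
      using 3 assms by (intro add_mono mult_left_mono) auto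
    also have "\<dots> = a * b" using 3 by (simp add: power2_eq_square)
    finally show ?thesis .
  qed
qed

text \<open>Minkowski's inequality in \<open>L\<^sup>2\<close>, in the same form with upper bounds for the norms.\<close>

lemma integral_sum_power2_le:
  assumes "\<And>d. d \<in> D \<Longrightarrow> bounded_measurable (f d)"
    and "\<And>d. d \<in> D \<Longrightarrow> (\<integral>x. (f d x)\<^sup>2 \<partial>P) \<le> (a d)\<^sup>2"
    and "\<And>d. d \<in> D \<Longrightarrow> a d \<ge> 0"
  shows "(\<integral>x. (\<Sum>d\<in>D. f d x)\<^sup>2 \<partial>P) \<le> (\<Sum>d\<in>D. a d)\<^sup>2"
proof -
  have "(\<integral>x. (\<Sum>d\<in>D. f d x)\<^sup>2 \<partial>P) = (\<integral>x. (\<Sum>d\<in>D. \<Sum>d'\<in>D. f d x * f d' x) \<partial>P)"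
    by (simp add: power2_eq_square sum_product)
  also have "\<dots> = (\<Sum>d\<in>D. \<Sum>d'\<in>D. \<integral>x. f d x * f d' x \<partial>P)"
    using assms(1) by (simp add: integrable_bounded_measurable bounded_measurable_mult
        Bochner_Integration.integrable_sum)
  also have "\<dots> \<le> (\<Sum>d\<in>D. \<Sum>d'\<in>D. a d * a d')"
    using assms by (intro sum_mono integral_mult_le) auto
  also have "\<dots> = (\<Sum>d\<in>D. a d)\<^sup>2"
    by (simp add: power2_eq_square sum_product)
  finally show ?thesis .
qed

text \<open>Replacing a coordinate by its mean is a smaller change than replacing it by an independent copy, by
Jensen's inequality in the copy. This links conditional expectations to couplings.\<close>

lemma integral_diff_avg_power2_le:
  assumes h: "bounded_measurable h"
  shows "(\<integral>x. (h x - avg j h x)\<^sup>2 \<partial>P) \<le> (\<integral>x. (\<integral>y. (h x - h (x(j := y)))\<^sup>2 \<partial>Q) \<partial>P)"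
proof -
  obtain C where C: "\<And>x. x \<in> space P \<Longrightarrow> \<bar>h x\<bar> \<le> C"
    using h by (auto simp: bounded_measurable_def)
  have [measurable]: "h \<in> borel_measurable P" using h by (rule bounded_measurableD)
  define g where "g x y = h x - h (x(j := y))" for x y
  have g_bound: "\<bar>g x y\<bar> \<le> 2 * C" if "x \<in> space P" "y \<in> space Q" for x y
    using C[of x] C[of "x(j := y)"] that by (auto simp: g_def)
  have g2_bound: "(g x y)\<^sup>2 \<le> (2 * C)\<^sup>2" if "x \<in> space P" "y \<in> space Q" for x y
    using g_bound[OF that] by (metis abs_ge_zero power2_abs power_mono)
  have g_int: "integrable Q (g x)" "integrable Q (\<lambda>y. (g x y)\<^sup>2)" if [simp]: "x \<in> space P" for x
  proof -
    show "integrable Q (g x)"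
      using g_bound unfolding g_def[abs_def]
      by (intro Q.integrable_const_bound[where B="2 * C"] AE_I2) auto
    show "integrable Q (\<lambda>y. (g x y)\<^sup>2)"
      using g2_bound unfolding g_def[abs_def]
      by (intro Q.integrable_const_bound[where B="(2 * C)\<^sup>2"] AE_I2) auto
  qed
  have jensen: "(h x - avg j h x)\<^sup>2 \<le> (\<integral>y. (g x y)\<^sup>2 \<partial>Q)" if x: "x \<in> space P" for x
  proof -
    have "h x - avg j h x = (\<integral>y. g x y \<partial>Q)"
      unfolding g_def avg_def using integrable_resample[OF h x] by (simp add: Q.prob_space)
    moreover have "0 \<le> (\<integral>y. (g x y - (\<integral>y. g x y \<partial>Q))\<^sup>2 \<partial>Q)" by simp
    ultimately show ?thesis
      using Q.variance_eq[OF g_int[OF x]] by simp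
  qed
  have "integrable P (\<lambda>x. \<integral>y. (g x y)\<^sup>2 \<partial>Q)"
  proof (intro P.integrable_const_bound[where B="(2 * C)\<^sup>2"] AE_I2)
    fix x assume x: "x \<in> space P"
    have "(\<integral>y. (g x y)\<^sup>2 \<partial>Q) \<le> (2 * C)\<^sup>2"
      using g2_bound[OF x] g_int[OF x] by (intro Q.integral_le_const AE_I2) auto
    then show "norm (\<integral>y. (g x y)\<^sup>2 \<partial>Q) \<le> (2 * C)\<^sup>2" by simp
  next
    show "(\<lambda>x. \<integral>y. (g x y)\<^sup>2 \<partial>Q) \<in> borel_measurable P"
      unfolding g_def by measurable
  qed
  moreover have "integrable P (\<lambda>x. (h x - avg j h x)\<^sup>2)"
    by (intro integrable_bounded_measurable bounded_measurable_intros bounded_measurable_avg h)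
  ultimately show ?thesis
    using jensen unfolding g_def[symmetric] by (intro integral_mono)
qed

end

section \<open>Variance of sums over a functionally dependent sequence\<close>

text \<open>The coordinate \<open>j\<close> of a sequence is the innovation \<open>j\<close> steps ago, so a shift by \<open>d\<close> moves the present
back by \<open>d\<close>.\<close>

locale iid_sequence = iid_coordinates Q P for Q :: "'e measure" and P :: "(nat \<Rightarrow> 'e) measure"
begin

lemma distr_shift: "distr P P (\<lambda>x l. x (l + d)) = P"
  using distr_PiM_reindex[of UNIV "\<lambda>_. Q" "\<lambda>l. l + d" UNIV] Q.prob_space_axioms
  by (simp add: P_eq restrict_UNIV)

lemma measurable_shift [measurable]: "(\<lambda>x l. x (l + d)) \<in> P \<rightarrow>\<^sub>M P"
  unfolding P_eq by (rule measurable_PiM_single') (auto simp: space_PiM)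

text \<open>The \<open>d\<close>-th summand depends on the coordinate \<open>j\<close> only if \<open>j \<ge> d\<close>, and then, by stationarity, as the
unshifted indicator depends on the coordinate \<open>j - d\<close>. So its \<open>j\<close>-th Efron--Stein term has norm at
most \<open>\<theta> (j - d)\<close>. Both the row and the column sums of this triangular array are at most
\<open>\<Theta> = \<Sum>k. \<theta> k\<close>; of the squared row sum one factor is bounded by \<open>\<Theta>\<close>, and the other one is summed along
columns.\<close>

proposition variance_shift_sum_le:
  fixes \<theta> :: "nat \<Rightarrow> real"
  assumes A: "A \<in> sets P" and \<theta>: "summable \<theta>" "\<And>k. 0 \<le> \<theta> k"
    and dep: "\<And>k. (\<integral>x. (\<integral>y. (indicator A x - indicator A (x(k := y)))\<^sup>2 \<partial>Q) \<partial>P) \<le> (\<theta> k)\<^sup>2"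
  shows "(\<integral>x. ((\<Sum>d<n. indicator A (\<lambda>l. x (l + d))) - real n * P.prob A)\<^sup>2 \<partial>P)
    \<le> real n * (\<Sum>k. \<theta> k)\<^sup>2"
proof -
  define \<Theta> where "\<Theta> = (\<Sum>k. \<theta> k)"
  define B where "B d = (\<lambda>x l. x (l + d)) -` A \<inter> space P" for d :: nat
  have B: "B d \<in> sets P" for d
    unfolding B_def using A by measurable
  have ind_B: "indicator (B d) x = (indicator A (\<lambda>l. x (l + d)) :: real)" if "x \<in> space P" for d x
    using that by (auto simp: B_def indicator_def)
  have prob_B: "P.prob (B d) = P.prob A" for d
  proof -
    have "P.prob (B d) = measure (distr P P (\<lambda>x l. x (l + d))) A"
      unfolding B_def using A by (simp add: measure_distr)
    then show ?thesis by (simp only: distr_shift)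
  qed
  define S where "S = (\<lambda>x. \<Sum>d<n. indicator (B d) x :: real)"
  define a where "a d j = (if d \<le> j then \<theta> (j - d) else 0)" for d j
  have a0: "0 \<le> a d j" for d j by (simp add: a_def \<theta>)
  have ind: "bounded_measurable (indicator (B d))" for d
    by (intro bounded_measurable_indicator B)
  have coord: "(\<integral>x. (indicator (B d) x - avg j (indicator (B d)) x)\<^sup>2 \<partial>P) \<le> (a d j)\<^sup>2" for d j
  proof -
    define \<psi> :: "nat \<Rightarrow> (nat \<Rightarrow> 'e) \<Rightarrow> real"
      where "\<psi> k x = (\<integral>y. (indicator A x - indicator A (x(k := y)))\<^sup>2 \<partial>Q)" for k x
    have \<psi>_meas: "\<psi> k \<in> borel_measurable P" for k
      unfolding \<psi>_def[abs_def] using A by measurable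
    have shift: "(\<lambda>l. x (l + d)) \<in> space P" if "x \<in> space P" for x
      using measurable_space[OF measurable_shift that] .
    have "(\<integral>x. (indicator (B d) x - avg j (indicator (B d)) x)\<^sup>2 \<partial>P)
        \<le> (\<integral>x. (\<integral>y. (indicator (B d) x - indicator (B d) (x(j := y)))\<^sup>2 \<partial>Q) \<partial>P)"
      by (rule integral_diff_avg_power2_le[OF ind])
    also have "\<dots> = (\<integral>x. (if d \<le> j then \<psi> (j - d) (\<lambda>l. x (l + d)) else 0) \<partial>P)"
    proof (intro Bochner_Integration.integral_cong refl)
      fix x assume x: "x \<in> space P"
      have "(\<integral>y. (indicator (B d) x - indicator (B d) (x(j := y)) :: real)\<^sup>2 \<partial>Q)
          = (\<integral>y. (indicator A (\<lambda>l. x (l + d)) - indicator A (\<lambda>l. (x(j := y)) (l + d)))\<^sup>2 \<partial>Q)"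
        by (intro Bochner_Integration.integral_cong refl)
          (simp only: ind_B[OF x] ind_B[OF fun_upd_in_space[OF x]])
      also have "\<dots> = (if d \<le> j then \<psi> (j - d) (\<lambda>l. x (l + d)) else 0)"
      proof (cases "d \<le> j")
        case True
        then have "(\<lambda>l. (x(j := y)) (l + d)) = (\<lambda>l. x (l + d))(j - d := y)" for y
          by (auto simp: fun_eq_iff)
        with True show ?thesis by (simp add: \<psi>_def)
      next
        case False
        then have "(\<lambda>l. (x(j := y)) (l + d)) = (\<lambda>l. x (l + d))" for y
          by (auto simp: fun_eq_iff)
        with False show ?thesis by simp
      qed
      finally show "(\<integral>y. (indicator (B d) x - indicator (B d) (x(j := y)))\<^sup>2 \<partial>Q)
          = (if d \<le> j then \<psi> (j - d) (\<lambda>l. x (l + d)) else 0)" .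
    qed
    also have "\<dots> \<le> (a d j)\<^sup>2"
    proof (cases "d \<le> j")
      case True
      have "(\<integral>x. \<psi> (j - d) (\<lambda>l. x (l + d)) \<partial>P) = (\<integral>x. \<psi> (j - d) x \<partial>distr P P (\<lambda>x l. x (l + d)))"
        by (rule integral_distr[symmetric, OF measurable_shift \<psi>_meas])
      also have "\<dots> = (\<integral>x. \<psi> (j - d) x \<partial>P)" by (simp only: distr_shift)
      also have "\<dots> \<le> (\<theta> (j - d))\<^sup>2" using dep[of "j - d"] by (simp add: \<psi>_def)
      finally show ?thesis using True by (simp add: a_def)
    qed (simp add: a_def)
    finally show ?thesis .
  qed
  have partial: "(\<Sum>i\<in>I. \<theta> i) \<le> \<Theta>" if "finite I" for I
    unfolding \<Theta>_def using \<theta> that by (intro sum_le_suminf) auto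
  have \<Theta>0: "0 \<le> \<Theta>" unfolding \<Theta>_def using \<theta> by (intro suminf_nonneg)
  have row: "(\<Sum>d<n. a d j) \<le> \<Theta>" for j
  proof -
    have "(\<Sum>d<n. a d j) = (\<Sum>d\<in>{..<n} \<inter> {..j}. \<theta> (j - d))"
      unfolding a_def by (simp add: sum.If_cases Int_def atMost_def)
    also have "\<dots> = (\<Sum>i\<in>(\<lambda>d. j - d) ` ({..<n} \<inter> {..j}). \<theta> i)"
      by (subst sum.reindex) (auto simp: inj_on_def)
    also have "\<dots> \<le> \<Theta>" by (intro partial) auto
    finally show ?thesis .
  qed
  have col: "(\<Sum>j\<in>J. a d j) \<le> \<Theta>" if "finite J" for J d
  proof -
    have "(\<Sum>j\<in>J. a d j) = (\<Sum>j\<in>J \<inter> {d..}. \<theta> (j - d))"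
      unfolding a_def using that by (simp add: sum.If_cases Int_def atLeast_def)
    also have "\<dots> = (\<Sum>i\<in>(\<lambda>j. j - d) ` (J \<inter> {d..}). \<theta> i)"
      by (subst sum.reindex) (auto simp: inj_on_def)
    also have "\<dots> \<le> \<Theta>" using that by (intro partial) auto
    finally show ?thesis .
  qed
  have "(\<integral>x. (S x - (\<Sum>d<n. P.prob (B d)))\<^sup>2 \<partial>P) \<le> real n * \<Theta>\<^sup>2"
    unfolding S_def
  proof (rule efron_stein)
    fix J :: "nat set" assume J: "finite J"
    have "(\<Sum>j\<in>J. \<integral>x. ((\<Sum>d<n. indicator (B d) x) - avg j (\<lambda>x. \<Sum>d<n. indicator (B d) x) x)\<^sup>2 \<partial>P)
        = (\<Sum>j\<in>J. \<integral>x. (\<Sum>d<n. indicator (B d) x - avg j (indicator (B d)) x)\<^sup>2 \<partial>P)"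
      by (intro sum.cong refl Bochner_Integration.integral_cong)
        (simp add: avg_sum ind sum_subtractf)
    also have "\<dots> \<le> (\<Sum>j\<in>J. (\<Sum>d<n. a d j)\<^sup>2)"
      by (intro sum_mono integral_sum_power2_le coord a0 bounded_measurable_intros
          bounded_measurable_avg B)
    also have "\<dots> \<le> (\<Sum>j\<in>J. \<Theta> * (\<Sum>d<n. a d j))"
      unfolding power2_eq_square
      by (intro sum_mono mult_right_mono row sum_nonneg a0)
    also have "\<dots> = \<Theta> * (\<Sum>d<n. \<Sum>j\<in>J. a d j)"
      by (subst sum.swap) (simp add: sum_distrib_left)
    also have "\<dots> \<le> \<Theta> * (\<Sum>d<n. \<Theta>)"
      by (intro mult_left_mono sum_mono col J \<Theta>0)
    finally show "(\<Sum>j\<in>J. \<integral>x. ((\<Sum>d<n. indicator (B d) x)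
        - avg j (\<lambda>x. \<Sum>d<n. indicator (B d) x) x)\<^sup>2 \<partial>P) \<le> real n * \<Theta>\<^sup>2"
      by (simp add: power2_eq_square ac_simps)
  qed (use B in auto)
  also have "(\<integral>x. (S x - (\<Sum>d<n. P.prob (B d)))\<^sup>2 \<partial>P)
      = (\<integral>x. ((\<Sum>d<n. indicator A (\<lambda>l. x (l + d))) - real n * P.prob A)\<^sup>2 \<partial>P)"
    by (intro Bochner_Integration.integral_cong refl) (simp add: S_def ind_B prob_B)
  finally show ?thesis by (simp add: \<Theta>_def)
qed

end

section \<open>Empirical quantiles as counts\<close>

lemma order_statistic_le_iff:
  assumes "1 \<le> k" "k \<le> length vs"
  shows "order_statistic k vs \<le> c \<longleftrightarrow> k \<le> length (filter (\<lambda>v. v \<le> c) vs)"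
proof -
  define xs where "xs = sort vs"
  have xs: "sorted xs" "length xs = length vs" by (simp_all add: xs_def)
  have "length (filter (\<lambda>v. v \<le> c) vs) = length (filter (\<lambda>v. v \<le> c) xs)"
    by (simp add: xs_def filter_sort)
  also have "\<dots> = card {i. i < length xs \<and> xs ! i \<le> c}"
    by (rule length_filter_conv_card)
  finally have len: "length (filter (\<lambda>v. v \<le> c) vs) = card {i. i < length xs \<and> xs ! i \<le> c}" .
  show ?thesis
  proof
    assume "order_statistic k vs \<le> c"
    then have "xs ! (k - 1) \<le> c" by (simp add: order_statistic_def xs_def)
    then have "{..<k} \<subseteq> {i. i < length xs \<and> xs ! i \<le> c}"
    proof safe
      fix i assume i: "i < k"
      then have "xs ! i \<le> xs ! (k - 1)" using assms xs by (intro sorted_nth_mono) auto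
      also note \<open>xs ! (k - 1) \<le> c\<close>
      finally show "xs ! i \<le> c" .
      show "i < length xs" using i assms xs by simp
    qed
    from card_mono[OF _ this] show "k \<le> length (filter (\<lambda>v. v \<le> c) vs)"
      by (simp add: len)
  next
    assume k: "k \<le> length (filter (\<lambda>v. v \<le> c) vs)"
    show "order_statistic k vs \<le> c"
    proof (rule ccontr)
      assume "\<not> order_statistic k vs \<le> c"
      then have gt: "c < xs ! (k - 1)" by (simp add: order_statistic_def xs_def)
      have "{i. i < length xs \<and> xs ! i \<le> c} \<subseteq> {..<k - 1}"
      proof safe
        fix i assume i: "i < length xs" "xs ! i \<le> c"
        show "i < k - 1"
        proof (rule ccontr)
          assume "\<not> i < k - 1"
          then have "xs ! (k - 1) \<le> xs ! i" using i xs by (intro sorted_nth_mono) auto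
          then show False using gt i by simp
        qed
      qed
      from card_mono[OF _ this] show False using k assms by (simp add: len)
    qed
  qed
qed

lemma length_filter_map_upto:
  "real (length (filter (\<lambda>x. x \<le> c) (map v [1..int n]))) = (\<Sum>i\<in>{1..int n}. indicator {..c} (v i))"
proof -
  have "length (filter (\<lambda>x. x \<le> c) (map v [1..int n])) = card ({i. v i \<le> c} \<inter> {1..int n})"
    by (simp add: filter_map comp_def distinct_length_filter)
  moreover have "(\<Sum>i\<in>{1..int n}. indicator {..c} (v i)) = real (card ({i. v i \<le> c} \<inter> {1..int n}))"
    by (simp add: indicator_def Int_commute sum.If_cases Collect_conj_eq)
  ultimately show ?thesis by simp
qed

text \<open>The rank exceeds \<open>n (1 - \<alpha>)\<close> by at most \<open>1 - \<alpha>\<close> from the factor \<open>n + 1\<close> and \<open>1\<close> from rounding up; this is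
the origin of the term \<open>2 / n\<close> in the coverage bounds.\<close>

lemma conformal_rank_bounds:
  assumes "0 < \<alpha>" "\<alpha> < 1"
  shows "1 \<le> conformal_rank \<alpha> n" "real n * (1 - \<alpha>) \<le> real (conformal_rank \<alpha> n)"
    "real (conformal_rank \<alpha> n) \<le> real n * (1 - \<alpha>) + 2"
proof -
  define z where "z = (real n + 1) * (1 - \<alpha>)"
  have z: "z > 0" unfolding z_def using assms by (intro mult_pos_pos) auto
  have r: "real (conformal_rank \<alpha> n) = of_int \<lceil>z\<rceil>"
    using z by (simp add: conformal_rank_def z_def[symmetric])
  have eq: "z = real n * (1 - \<alpha>) + (1 - \<alpha>)" by (simp add: z_def algebra_simps)
  have "\<lceil>z\<rceil> \<ge> 1" using z by (simp add: one_le_ceiling)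
  then show "1 \<le> conformal_rank \<alpha> n"
    by (simp add: conformal_rank_def z_def[symmetric] le_nat_iff)
  show "real n * (1 - \<alpha>) \<le> real (conformal_rank \<alpha> n)"
    unfolding r using le_of_int_ceiling[of z] eq assms by linarith
  show "real (conformal_rank \<alpha> n) \<le> real n * (1 - \<alpha>) + 2"
    unfolding r using of_int_ceiling_le_add_one[of z] eq assms by linarith
qed

text \<open>If the rank exceeds \<open>n\<close>, both sides are false, so the convention of an infinite quantile needs no
separate treatment from here on.\<close>

lemma conformal_quantile_le_iff:
  assumes "0 < \<alpha>" "\<alpha> < 1"
  shows "conformal_quantile \<alpha> n v \<le> ereal c
    \<longleftrightarrow> real (conformal_rank \<alpha> n) \<le> (\<Sum>i\<in>{1..int n}. indicator {..c} (v i))"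
proof (cases "conformal_rank \<alpha> n \<le> n")
  case True
  then show ?thesis
    using conformal_rank_bounds(1)[OF assms, of n]
    by (simp add: conformal_quantile_def order_statistic_le_iff
        length_filter_map_upto[symmetric])
next
  case False
  have "(\<Sum>i\<in>{1..int n}. indicator {..c} (v i)) \<le> (\<Sum>i\<in>{1..int n}. 1::real)"
    by (intro sum_mono) (auto simp: indicator_def)
  then show ?thesis using False by (simp add: conformal_quantile_def)
qed

lemma mem_conformal_set_iff:
  "y \<in> conformal_set \<mu> (conformal_quantile \<alpha> n v) x
    \<longleftrightarrow> ereal \<bar>y - \<mu> x\<bar> \<le> conformal_quantile \<alpha> n v"
proof (cases "conformal_rank \<alpha> n > n")
  case False
  then obtain r where "conformal_quantile \<alpha> n v = ereal r"
    by (simp add: conformal_quantile_def)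
  then show ?thesis by (auto simp: conformal_set_def abs_le_iff)
qed (simp add: conformal_quantile_def conformal_set_def)

section \<open>Coverage from second moments\<close>

context prob_space
begin

text \<open>A layer-cake estimate without an integral. Here \<open>E\<close> is an error event, \<open>R\<close> the
distance of the new score from the target quantile and \<open>B s\<close> the event, decided by the past, that the
empirical quantile is off by at least \<open>s\<close>. The range of \<open>R\<close> is cut at \<open>s\<^sub>j = c + b 2\<^sup>j\<close>: the first cell costs
\<open>L (c + b)\<close>, and the cell \<open>[s\<^sub>j, s\<^sub>j\<^sub>+\<^sub>1]\<close> costs \<open>L b 2\<^sup>j\<close> times \<open>a\<^sup>2 / (b 2\<^sup>j)\<^sup>2\<close>, which sums to
\<open>2 L a\<^sup>2 / b\<close>. The choice \<open>b = sqrt 2 * a\<close> minimises \<open>b + 2 a\<^sup>2 / b\<close>.\<close>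

lemma geometric_grid_bound:
  fixes R :: "'a \<Rightarrow> real" and B :: "real \<Rightarrow> 'a set" and L a c e :: real
  assumes [measurable]: "E \<in> events" "R \<in> borel_measurable M"
    and \<F>: "\<F> \<subseteq> events" "space M \<in> \<F>" "\<And>s. B s \<in> \<F>"
    and pos: "L \<ge> 0" "a > 0" "c \<ge> 0" "e > 0"
    and R_nonneg: "\<And>\<omega>. \<omega> \<in> E \<Longrightarrow> 0 \<le> R \<omega>"
    and E_B: "\<And>s \<omega>. 0 \<le> s \<Longrightarrow> s \<le> e \<Longrightarrow> \<omega> \<in> E \<Longrightarrow> s < R \<omega> \<Longrightarrow> \<omega> \<in> B s"
    and local_bound: "\<And>B s s'. B \<in> \<F> \<Longrightarrow> 0 \<le> s \<Longrightarrow> s \<le> s' \<Longrightarrow> s' \<le> e \<Longrightarrow>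
      prob (B \<inter> {\<omega> \<in> space M. s \<le> R \<omega> \<and> R \<omega> \<le> s'}) \<le> L * (s' - s) * prob B"
    and tail: "\<And>s. c < s \<Longrightarrow> s \<le> e \<Longrightarrow> prob (B s) \<le> a\<^sup>2 / (s - c)\<^sup>2"
  shows "prob E \<le> L * (c + 2 * sqrt 2 * a) + prob (B e)"
proof -
  have [measurable]: "B s \<in> events" for s using \<F> by auto
  have E_sub: "E \<subseteq> space M" using sets.sets_into_space[OF assms(1)] .
  define b where "b = sqrt 2 * a"
  have b: "b > 0" using pos by (simp add: b_def)
  define s where "s j = c + b * 2 ^ j" for j :: nat
  have s_pos: "c < s j" for j using b by (simp add: s_def)
  have s_mono: "s j \<le> s (Suc j)" for j using b by (simp add: s_def)
  define U where "U j = E \<inter> {\<omega> \<in> space M. R \<omega> \<le> min e (s j)}" for j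
  have [measurable]: "U j \<in> events" for j unfolding U_def by measurable
  have chain: "prob (U j) \<le> L * (c + b) + L * (a\<^sup>2 / b) * (2 - 2 * (1 / 2) ^ j)" for j
  proof (induction j)
    case 0
    have "prob (U 0) \<le> prob (space M \<inter> {\<omega> \<in> space M. 0 \<le> R \<omega> \<and> R \<omega> \<le> min e (s 0)})"
      unfolding U_def using R_nonneg E_sub by (intro finite_measure_mono) auto
    also have "\<dots> \<le> L * (min e (s 0) - 0) * prob (space M)"
      using pos s_pos[of 0] by (intro local_bound \<F>) auto
    also have "\<dots> \<le> L * (c + b)"
      using pos by (simp add: prob_space s_def mult_left_mono)
    finally show ?case by simp
  next
    case (Suc j)
    have step0: "0 \<le> L * (a\<^sup>2 / b) * (1 / 2) ^ j" using pos b by simp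
    have "prob (U (Suc j)) \<le> prob (U j) + L * (a\<^sup>2 / b) * (1 / 2) ^ j"
    proof (cases "s j \<le> e")
      case False
      then have "U (Suc j) = U j" using s_mono[of j] by (simp add: U_def min_def)
      then show ?thesis using step0 by simp
    next
      case True
      let ?I = "{\<omega> \<in> space M. s j \<le> R \<omega> \<and> R \<omega> \<le> min e (s (Suc j))}"
      have "U (Suc j) \<subseteq> U j \<union> (B (s j) \<inter> ?I)"
      proof
        fix \<omega> assume \<omega>: "\<omega> \<in> U (Suc j)"
        show "\<omega> \<in> U j \<union> (B (s j) \<inter> ?I)"
        proof (cases "s j < R \<omega>")
          case True
          have "0 \<le> s j" using s_pos[of j] pos by simp
          then have "\<omega> \<in> B (s j)" using E_B[of "s j" \<omega>] \<open>s j \<le> e\<close> \<omega> True by (simp add: U_def)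
          with \<omega> True show ?thesis by (simp add: U_def)
        qed (use \<omega> in \<open>simp add: U_def\<close>)
      qed
      then have "prob (U (Suc j)) \<le> prob (U j \<union> (B (s j) \<inter> ?I))"
        by (intro finite_measure_mono) auto
      also have "\<dots> \<le> prob (U j) + prob (B (s j) \<inter> ?I)"
        by (intro measure_Un_le) auto
      also have "prob (B (s j) \<inter> ?I) \<le> L * (min e (s (Suc j)) - s j) * prob (B (s j))"
        using True s_pos[of j] s_mono[of j] pos by (intro local_bound \<F>) auto
      also have "\<dots> \<le> L * (b * 2 ^ j) * (a\<^sup>2 / (b * 2 ^ j)\<^sup>2)"
      proof (rule mult_mono)
        show "L * (min e (s (Suc j)) - s j) \<le> L * (b * 2 ^ j)"
          using pos by (intro mult_left_mono) (auto simp: s_def)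
        show "prob (B (s j)) \<le> a\<^sup>2 / (b * 2 ^ j)\<^sup>2"
          using tail[of "s j"] True s_pos[of j] by (simp add: s_def)
      qed (use pos b in auto)
      also have "\<dots> = L * (a\<^sup>2 / b) * (1 / 2) ^ j"
        using b by (simp add: field_simps power2_eq_square)
      finally show ?thesis by simp
    qed
    also have "\<dots> \<le> L * (c + b) + L * (a\<^sup>2 / b) * (2 - 2 * (1 / 2) ^ j) + L * (a\<^sup>2 / b) * (1 / 2) ^ j"
      using Suc by simp
    also have "\<dots> = L * (c + b) + L * (a\<^sup>2 / b) * (2 - 2 * (1 / 2) ^ Suc j)"
      by (simp add: algebra_simps)
    finally show ?case .
  qed
  obtain j where j: "e \<le> s j"
  proof -
    obtain j where "e / b < 2 ^ j" using real_arch_pow[of 2 "e / b"] by auto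
    then have "e < b * 2 ^ j" using b by (simp add: field_simps)
    then have "e \<le> s j" using pos by (simp add: s_def)
    then show ?thesis by (rule that)
  qed
  have "E \<subseteq> U j \<union> B e"
    using E_B[of e] j pos E_sub by (auto simp: U_def not_le[symmetric])
  then have "prob E \<le> prob (U j \<union> B e)"
    by (intro finite_measure_mono) auto
  also have "\<dots> \<le> prob (U j) + prob (B e)"
    by (intro measure_Un_le) auto
  also have "prob (U j) \<le> L * (c + b) + L * (a\<^sup>2 / b) * (2 - 2 * (1 / 2) ^ j)"
    by (rule chain)
  also have "\<dots> \<le> L * (c + b) + L * (a\<^sup>2 / b) * 2"
    using pos b by (intro add_left_mono mult_left_mono) auto
  also have "\<dots> = L * (c + 2 * sqrt 2 * a)"
  proof -
    have "a\<^sup>2 / b * 2 = b"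
      using pos by (simp add: b_def field_simps power2_eq_square)
    then have "L * (a\<^sup>2 / b) * 2 = L * b" by (metis mult.assoc)
    then show ?thesis by (simp add: b_def algebra_simps)
  qed
  finally show ?thesis by simp
qed

lemma cdf_distr_eq:
  "W \<in> borel_measurable M \<Longrightarrow> cdf (distr M borel W) c = prob {\<omega> \<in> space M. W \<omega> \<le> c}"
  by (simp add: cdf_def measure_distr vimage_def Int_def conj_commute)

lemma continuous_cdf_attains:
  assumes [measurable]: "W \<in> borel_measurable M"
    and cont: "continuous_on UNIV (cdf (distr M borel W))" and p: "0 < p" "p < 1"
  shows "\<exists>c. cdf (distr M borel W) c = p"
proof -
  interpret W: real_distribution "distr M borel W"
    by (intro real_distribution_distr) simp
  let ?F = "cdf (distr M borel W)"
  have "\<forall>\<^sub>F x in at_bot. ?F x < p"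
    using W.cdf_lim_at_bot p by (intro order_tendstoD)
  then obtain l where l: "?F l < p"
    by (meson eventually_at_bot_linorder order_refl)
  have "\<forall>\<^sub>F x in at_top. ?F x > p"
    using W.cdf_lim_at_top_prob p by (intro order_tendstoD)
  then obtain u where u: "\<And>x. x \<ge> u \<Longrightarrow> ?F x > p"
    by (meson eventually_at_top_linorder)
  show ?thesis
    using IVT'[of ?F l p "max l u"] l u[of "max l u"] continuous_on_subset[OF cont] by force
qed

end

text \<open>What the coverage bounds use: a new score \<open>W\<close> with distribution function \<open>F\<close>, and a random threshold \<open>Q\<close>
that is the empirical quantile belonging to the counts \<open>N c\<close>. The law of \<open>W\<close>
given the counts enters later, and only when densities are available.\<close>

locale split_conformal = prob_space M for M :: "'w measure" +
  fixes W :: "'w \<Rightarrow> real" and N :: "real \<Rightarrow> 'w \<Rightarrow> real" and Q :: "'w \<Rightarrow> ereal"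
    and F :: "real \<Rightarrow> real" and n k :: nat and D \<alpha> :: real
  assumes W [measurable]: "W \<in> borel_measurable M"
    and N [measurable]: "\<And>c. N c \<in> borel_measurable M"
    and N_bound: "\<And>c \<omega>. \<bar>N c \<omega>\<bar> \<le> real n"
    and Q_le: "\<And>c \<omega>. Q \<omega> \<le> ereal c \<longleftrightarrow> real k \<le> N c \<omega>"
    and F: "F = cdf (distr M borel W)"
    and F_cont: "continuous_on UNIV F"
    and second_moment: "\<And>c. expectation (\<lambda>\<omega>. (N c \<omega> - real n * F c)\<^sup>2) \<le> real n * D\<^sup>2"
    and n: "n \<ge> 1" and D: "D > 0" and \<alpha>: "0 < \<alpha>" "\<alpha> < 1"
    and k: "real n * (1 - \<alpha>) \<le> real k" "real k \<le> real n * (1 - \<alpha>) + 2"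
begin

definition covered :: "'w set" where
  "covered = {\<omega> \<in> space M. ereal (W \<omega>) \<le> Q \<omega>}"

lemma F_eq: "F c = prob {\<omega> \<in> space M. W \<omega> \<le> c}"
  unfolding F by (rule cdf_distr_eq[OF W])

lemma covered_le: "\<omega> \<in> covered \<Longrightarrow> real k \<le> N c \<omega> \<Longrightarrow> W \<omega> \<le> c"
  unfolding Q_le[symmetric] covered_def using order_trans[of "ereal (W \<omega>)" "Q \<omega>" "ereal c"] by simp

lemma not_covered_gt:
  assumes "\<omega> \<in> space M - covered" "N c \<omega> < real k"
  shows "c < W \<omega>"
proof -
  have "Q \<omega> < ereal (W \<omega>)" using assms(1) by (auto simp: covered_def not_le)
  moreover have "ereal c < Q \<omega>" using assms(2) Q_le[of \<omega> c] by (simp add: not_le[symmetric])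
  ultimately show ?thesis by (metis ereal_less(2) less_ereal.simps(1) order.strict_trans)
qed

text \<open>The threshold enters only through its comparisons with real numbers, so measurability goes through a
rational separating \<open>Q\<close> from \<open>W\<close>.\<close>

lemma covered_event [measurable]: "covered \<in> events"
proof -
  have "ereal (W \<omega>) \<le> Q \<omega> \<longleftrightarrow> \<not> (\<exists>r::rat. real k \<le> N (of_rat r) \<omega> \<and> of_rat r < W \<omega>)" for \<omega>
  proof
    assume "ereal (W \<omega>) \<le> Q \<omega>"
    then show "\<not> (\<exists>r::rat. real k \<le> N (of_rat r) \<omega> \<and> of_rat r < W \<omega>)"
      unfolding Q_le[symmetric] by (metis ereal_less_eq(3) not_le order_trans)
  next
    assume *: "\<not> (\<exists>r::rat. real k \<le> N (of_rat r) \<omega> \<and> of_rat r < W \<omega>)"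
    show "ereal (W \<omega>) \<le> Q \<omega>"
    proof (rule ccontr)
      assume "\<not> ereal (W \<omega>) \<le> Q \<omega>"
      then have "Q \<omega> < ereal (W \<omega>)" by simp
      then obtain z where z: "Q \<omega> < ereal z" "z < W \<omega>"
        using ereal_dense2 by fastforce
      obtain r where r: "z < of_rat r" "of_rat r < W \<omega>"
        using of_rat_dense[OF z(2)] by blast
      have "Q \<omega> \<le> ereal (of_rat r)"
        using z(1) r(1) by (metis ereal_less_eq(3) less_imp_le order_trans)
      with * r show False by (auto simp: Q_le)
    qed
  qed
  then have "covered = {\<omega> \<in> space M. \<not> (\<exists>r::rat. real k \<le> N (of_rat r) \<omega> \<and> of_rat r < W \<omega>)}"
    by (simp add: covered_def)
  also have "\<dots> \<in> events" by measurable
  finally show ?thesis .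
qed

lemma deviation:
  assumes \<delta>: "\<delta> > 0"
  shows "prob {\<omega> \<in> space M. \<bar>N c \<omega> - real n * F c\<bar> \<ge> real n * \<delta>} \<le> D\<^sup>2 / (real n * \<delta>\<^sup>2)"
proof -
  have "integrable M (\<lambda>\<omega>. (N c \<omega> - real n * F c)\<^sup>2)"
  proof (intro integrable_const_bound[where B="(real n + \<bar>real n * F c\<bar>)\<^sup>2"] AE_I2)
    fix \<omega>
    have "\<bar>N c \<omega> - real n * F c\<bar> \<le> real n + \<bar>real n * F c\<bar>"
      using N_bound[of c \<omega>] by linarith
    then show "norm ((N c \<omega> - real n * F c)\<^sup>2) \<le> (real n + \<bar>real n * F c\<bar>)\<^sup>2"
      by (simp add: abs_le_square_iff[symmetric])
  qed measurable
  then have "prob {\<omega> \<in> space M. \<bar>N c \<omega> - real n * F c\<bar> \<ge> real n * \<delta>}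
      \<le> expectation (\<lambda>\<omega>. (N c \<omega> - real n * F c)\<^sup>2) / (real n * \<delta>)\<^sup>2"
    using n \<delta> by (intro second_moment_method) auto
  also have "\<dots> \<le> real n * D\<^sup>2 / (real n * \<delta>)\<^sup>2"
    using second_moment by (intro divide_right_mono) auto
  also have "\<dots> = D\<^sup>2 / (real n * \<delta>\<^sup>2)"
    using n by (simp add: power_mult_distrib power2_eq_square)
  finally show ?thesis .
qed

text \<open>At a threshold where \<open>F\<close> is \<open>\<delta>\<close> above \<open>k / n\<close> the quantile is unlikely to lie beyond it, and where \<open>F\<close> is \<open>\<delta>\<close>
below \<open>k / n\<close> the quantile is unlikely to lie before it: either way the count misses its mean by \<open>n \<delta>\<close>.\<close>

lemma few_below:
  assumes "\<delta> > 0" "F c \<ge> real k / real n + \<delta>"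
  shows "prob {\<omega> \<in> space M. N c \<omega> < real k} \<le> D\<^sup>2 / (real n * \<delta>\<^sup>2)"
proof -
  have "real n * F c \<ge> real k + real n * \<delta>"
    using assms n mult_left_mono[of "real k / real n + \<delta>" "F c" "real n"] by (simp add: algebra_simps)
  then have "prob {\<omega> \<in> space M. N c \<omega> < real k}
      \<le> prob {\<omega> \<in> space M. \<bar>N c \<omega> - real n * F c\<bar> \<ge> real n * \<delta>}"
    by (intro finite_measure_mono) auto
  also note deviation[OF assms(1)]
  finally show ?thesis .
qed

lemma many_below:
  assumes "\<delta> > 0" "F c \<le> real k / real n - \<delta>"
  shows "prob {\<omega> \<in> space M. real k \<le> N c \<omega>} \<le> D\<^sup>2 / (real n * \<delta>\<^sup>2)"
proof -
  have "real n * F c \<le> real k - real n * \<delta>"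
    using assms n mult_left_mono[of "F c" "real k / real n - \<delta>" "real n"] by (simp add: algebra_simps)
  then have "prob {\<omega> \<in> space M. real k \<le> N c \<omega>}
      \<le> prob {\<omega> \<in> space M. \<bar>N c \<omega> - real n * F c\<bar> \<ge> real n * \<delta>}"
    by (intro finite_measure_mono) auto
  also note deviation[OF assms(1)]
  finally show ?thesis .
qed

lemma rank_fraction: "1 - \<alpha> \<le> real k / real n" "real k / real n \<le> 1 - \<alpha> + 2 / real n"
proof -
  show "1 - \<alpha> \<le> real k / real n" using k(1) n by (simp add: field_simps)
  have "real k / real n \<le> (real n * (1 - \<alpha>) + 2) / real n"
    using k(2) by (intro divide_right_mono) auto
  also have "\<dots> = 1 - \<alpha> + 2 / real n" using n by (simp add: field_simps)
  finally show "real k / real n \<le> 1 - \<alpha> + 2 / real n" .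
qed

text \<open>Without knowledge of the dependence between \<open>W\<close> and \<open>Q\<close>, coverage is compared with \<open>W \<le> c\<close> at a
deterministic \<open>c\<close>, at the price of a Chebyshev bound. The smallness hypothesis keeps \<open>k / n \<plusminus> \<delta>\<close> inside
\<open>(0, 1)\<close>, where the continuous \<open>F\<close> attains every value.\<close>

proposition coverage_continuous:
  assumes small: "2 / real n + (2 * D\<^sup>2 / real n) powr (1/3) < min \<alpha> (1 - \<alpha>)"
  shows "\<bar>prob covered - (1 - \<alpha>)\<bar> \<le> 2 / real n + 3 * (D\<^sup>2 / (4 * real n)) powr (1/3)"
proof -
  \<comment> \<open>The minimiser \<open>\<delta>\<close> of \<open>\<delta> + D\<^sup>2 / (n \<delta>\<^sup>2)\<close> satisfies \<open>\<delta>\<^sup>3 = 2 D\<^sup>2 / n\<close>; there the second summand is \<open>\<delta> / 2\<close>.\<close>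
  define x where "x = 2 * D\<^sup>2 / real n"
  define \<delta> where "\<delta> = x powr (1/3)"
  have x: "x > 0" using D n by (simp add: x_def)
  have \<delta>: "\<delta> > 0" using x by (simp add: \<delta>_def)
  have "\<delta> ^ 3 = x"
    using x by (simp add: \<delta>_def powr_realpow[symmetric] powr_powr)
  then have "D\<^sup>2 / real n = \<delta> ^ 3 / 2" by (simp add: x_def)
  then have "D\<^sup>2 / (real n * \<delta>\<^sup>2) = \<delta> ^ 3 / 2 / \<delta>\<^sup>2" by (metis divide_divide_eq_left)
  also have "\<dots> = \<delta> / 2" using \<delta> by (simp add: power3_eq_cube power2_eq_square)
  finally have dev: "D\<^sup>2 / (real n * \<delta>\<^sup>2) = \<delta> / 2" .
  have x8: "D\<^sup>2 / (4 * real n) = x / 2 ^ 3" by (simp add: x_def)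
  have root: "(x / 2 ^ 3) powr (1/3) = \<delta> / 2"
  proof -
    have "(2 ^ 3 :: real) powr (1/3) = 2"
      by (subst powr_realpow[symmetric], simp, subst powr_powr, simp)
    then show ?thesis using x by (simp add: powr_divide \<delta>_def)
  qed
  have rhs: "3 * (D\<^sup>2 / (4 * real n)) powr (1/3) = \<delta> + \<delta> / 2"
    unfolding x8 root by simp
  have small': "2 / real n + \<delta> < \<alpha>" "2 / real n + \<delta> < 1 - \<alpha>"
    using small by (auto simp: \<delta>_def x_def)
  have n0: "0 < 2 / real n" using n by simp
  have "0 < real k / real n + \<delta>" "real k / real n + \<delta> < 1"
    using rank_fraction small' \<delta> \<alpha> by linarith+
  then obtain u where u: "F u = real k / real n + \<delta>"
    using continuous_cdf_attains[OF W] F_cont unfolding F by blast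
  have "0 < real k / real n - \<delta>" "real k / real n - \<delta> < 1"
    using rank_fraction small' \<delta> \<alpha> n0 by linarith+
  then obtain l where l: "F l = real k / real n - \<delta>"
    using continuous_cdf_attains[OF W] F_cont unfolding F by blast
  have "prob covered \<le> prob ({\<omega> \<in> space M. W \<omega> \<le> u} \<union> {\<omega> \<in> space M. N u \<omega> < real k})"
    using covered_le[of _ u] by (intro finite_measure_mono) (auto simp: covered_def not_le[symmetric])
  also have "\<dots> \<le> F u + prob {\<omega> \<in> space M. N u \<omega> < real k}"
    unfolding F_eq by (intro measure_Un_le) auto
  also have "\<dots> \<le> F u + \<delta> / 2"
    using few_below[OF \<delta>, of u] u dev by simp
  finally have upper: "prob covered \<le> 1 - \<alpha> + 2 / real n + (\<delta> + \<delta> / 2)"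
    using u rank_fraction by linarith
  have "F l \<le> prob (covered \<union> {\<omega> \<in> space M. real k \<le> N l \<omega>})"
    unfolding F_eq using not_covered_gt[of _ l]
    by (intro finite_measure_mono) (auto simp: not_le[symmetric])
  also have "\<dots> \<le> prob covered + prob {\<omega> \<in> space M. real k \<le> N l \<omega>}"
    by (intro measure_Un_le) auto
  also have "\<dots> \<le> prob covered + \<delta> / 2"
    using many_below[OF \<delta>, of l] l dev by simp
  finally have lower: "1 - \<alpha> - (\<delta> + \<delta> / 2) \<le> prob covered"
    using l rank_fraction by linarith
  show ?thesis using upper lower n0 unfolding rhs by linarith
qed

text \<open>Over- and undercoverage relative to the event \<open>W \<le> q\<close> enter with opposite signs, so the larger
of the two probabilities bounds the error. By \<open>cond\<close>, each is an instance of the grid estimate with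
\<open>a = D / (c\<^sub>f sqrt n)\<close>. The offset \<open>c = 2 / (c\<^sub>f n)\<close> is the distance over which the growth of \<open>F\<close> only
makes up for the rounding of the rank; it arises on the upper side alone. Beyond distance \<open>e\<close>, where
the densities are not controlled, the tail bound is used directly, and \<open>large\<close> says that half of
\<open>c\<^sub>f e\<close> survives the rounding.\<close>

proposition coverage_density:
  fixes q e c\<^sub>f L :: real
  assumes Fq: "F q = 1 - \<alpha>" and pos: "e > 0" "c\<^sub>f > 0" "L > 0"
    and growth: "\<And>x y. q - e \<le> x \<Longrightarrow> x \<le> y \<Longrightarrow> y \<le> q + e \<Longrightarrow> c\<^sub>f * (y - x) \<le> F y - F x"
    and \<F>: "\<F> \<subseteq> events" "space M \<in> \<F>"
      "\<And>c. {\<omega> \<in> space M. N c \<omega> < real k} \<in> \<F>" "\<And>c. {\<omega> \<in> space M. real k \<le> N c \<omega>} \<in> \<F>"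
    and cond: "\<And>B x y. B \<in> \<F> \<Longrightarrow> q - e \<le> x \<Longrightarrow> x \<le> y \<Longrightarrow> y \<le> q + e \<Longrightarrow>
      prob (B \<inter> {\<omega> \<in> space M. x \<le> W \<omega> \<and> W \<omega> \<le> y}) \<le> L * (y - x) * prob B"
    and large: "2 / real n \<le> c\<^sub>f * e / 2"
  shows "\<bar>prob covered - (1 - \<alpha>)\<bar>
    \<le> 2 * L / (c\<^sub>f * real n) + 2 * sqrt 2 * L * D / (c\<^sub>f * sqrt (real n))
      + 8 * D\<^sup>2 / (real n * c\<^sub>f\<^sup>2 * e\<^sup>2)"
proof -
  define a where "a = D / (c\<^sub>f * sqrt (real n))"
  define c where "c = 2 / (c\<^sub>f * real n)"
  have a: "a > 0" using D n pos by (simp add: a_def)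
  have c: "c > 0" using n pos by (simp add: c_def)
  have cn: "2 / real n = c\<^sub>f * c" using pos by (simp add: c_def)
  have c_le: "c \<le> e / 2" using large pos unfolding cn by simp
  have tail_eq: "D\<^sup>2 / (real n * (c\<^sub>f * s)\<^sup>2) = a\<^sup>2 / s\<^sup>2" for s
    by (simp add: a_def power_divide power_mult_distrib ac_simps)
  define T where "T = 4 * D\<^sup>2 / (real n * c\<^sub>f\<^sup>2 * e\<^sup>2)"
  have T: "a\<^sup>2 / (e / 2)\<^sup>2 = T"
    by (simp add: T_def a_def power_divide power_mult_distrib ac_simps)
  have up: "prob {\<omega> \<in> space M. N (q + s) \<omega> < real k} \<le> a\<^sup>2 / (s - c)\<^sup>2" if "c < s" "s \<le> e" for s
  proof -
    have "c\<^sub>f * s \<le> F (q + s) - F q"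
      using growth[of q "q + s"] that pos c by simp
    then have "real k / real n + c\<^sub>f * (s - c) \<le> F (q + s)"
      using Fq rank_fraction(2) cn by (simp add: algebra_simps)
    then show ?thesis
      using few_below[of "c\<^sub>f * (s - c)" "q + s"] that pos by (simp add: tail_eq)
  qed
  have down: "prob {\<omega> \<in> space M. real k \<le> N (q - s) \<omega>} \<le> a\<^sup>2 / s\<^sup>2" if "0 < s" "s \<le> e" for s
  proof -
    have "c\<^sub>f * s \<le> F q - F (q - s)"
      using growth[of "q - s" q] that pos by simp
    then have "F (q - s) \<le> real k / real n - c\<^sub>f * s"
      using Fq rank_fraction(1) by (simp add: algebra_simps)
    then show ?thesis
      using many_below[of "c\<^sub>f * s" "q - s"] that pos by (simp add: tail_eq)
  qed
  have half: "a\<^sup>2 / s\<^sup>2 \<le> T" if "e / 2 \<le> s" for s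
    unfolding T[symmetric] using that pos
    by (intro divide_left_mono power_mono mult_pos_pos zero_less_power) auto
  let ?Over = "covered \<inter> {\<omega> \<in> space M. q < W \<omega>}"
  let ?Under = "{\<omega> \<in> space M. W \<omega> \<le> q} - covered"
  have "prob ?Over \<le> L * (c + 2 * sqrt 2 * a) + prob {\<omega> \<in> space M. N (q + e) \<omega> < real k}"
  proof (rule geometric_grid_bound[where \<F>=\<F> and R="\<lambda>\<omega>. W \<omega> - q"
        and B="\<lambda>s. {\<omega> \<in> space M. N (q + s) \<omega> < real k}"])
    fix s \<omega> assume "0 \<le> s" "s \<le> e" "\<omega> \<in> ?Over" "s < W \<omega> - q"
    then show "\<omega> \<in> {\<omega> \<in> space M. N (q + s) \<omega> < real k}"
      using covered_le[of \<omega> "q + s"] by force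
  next
    fix B s s' assume *: "B \<in> \<F>" "0 \<le> s" "s \<le> s'" "s' \<le> e"
    have "{\<omega> \<in> space M. s \<le> W \<omega> - q \<and> W \<omega> - q \<le> s'}
        = {\<omega> \<in> space M. q + s \<le> W \<omega> \<and> W \<omega> \<le> q + s'}"
      by auto
    then show "prob (B \<inter> {\<omega> \<in> space M. s \<le> W \<omega> - q \<and> W \<omega> - q \<le> s'}) \<le> L * (s' - s) * prob B"
      using cond[of B "q + s" "q + s'"] * pos by simp
  qed (use \<F> pos a c up in auto)
  also have "prob {\<omega> \<in> space M. N (q + e) \<omega> < real k} \<le> T"
    using up[of e] half[of "e - c"] c_le c pos by linarith
  finally have over: "prob ?Over \<le> L * (c + 2 * sqrt 2 * a) + T" by simp
  have "prob ?Under \<le> L * (0 + 2 * sqrt 2 * a) + prob {\<omega> \<in> space M. real k \<le> N (q - e) \<omega>}"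
  proof (rule geometric_grid_bound[where \<F>=\<F> and R="\<lambda>\<omega>. q - W \<omega>"
        and B="\<lambda>s. {\<omega> \<in> space M. real k \<le> N (q - s) \<omega>}"])
    fix s \<omega> assume "0 \<le> s" "s \<le> e" "\<omega> \<in> ?Under" "s < q - W \<omega>"
    then show "\<omega> \<in> {\<omega> \<in> space M. real k \<le> N (q - s) \<omega>}"
      using not_covered_gt[of \<omega> "q - s"] by force
  next
    fix B s s' assume *: "B \<in> \<F>" "0 \<le> s" "s \<le> s'" "s' \<le> e"
    have "{\<omega> \<in> space M. s \<le> q - W \<omega> \<and> q - W \<omega> \<le> s'}
        = {\<omega> \<in> space M. q - s' \<le> W \<omega> \<and> W \<omega> \<le> q - s}"
      by auto
    then show "prob (B \<inter> {\<omega> \<in> space M. s \<le> q - W \<omega> \<and> q - W \<omega> \<le> s'}) \<le> L * (s' - s) * prob B"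
      using cond[of B "q - s'" "q - s"] * pos by simp
  qed (use \<F> pos a down in auto)
  also have "prob {\<omega> \<in> space M. real k \<le> N (q - e) \<omega>} \<le> T"
    using down[of e] half[of e] pos by linarith
  also have "L * (0 + 2 * sqrt 2 * a) \<le> L * (c + 2 * sqrt 2 * a)"
    using c pos by (intro mult_left_mono) auto
  finally have under: "prob ?Under \<le> L * (c + 2 * sqrt 2 * a) + T" by simp
  have cov_split: "prob covered = prob (covered \<inter> {\<omega> \<in> space M. W \<omega> \<le> q}) + prob ?Over"
  proof -
    have "covered = covered \<inter> {\<omega> \<in> space M. W \<omega> \<le> q} \<union> ?Over"
      by (auto simp: covered_def)
    then show ?thesis
      using finite_measure_Union[of "covered \<inter> {\<omega> \<in> space M. W \<omega> \<le> q}" ?Over] by force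
  qed
  have F_split: "F q = prob (covered \<inter> {\<omega> \<in> space M. W \<omega> \<le> q}) + prob ?Under"
  proof -
    have "{\<omega> \<in> space M. W \<omega> \<le> q} = covered \<inter> {\<omega> \<in> space M. W \<omega> \<le> q} \<union> ?Under"
      by auto
    then show ?thesis unfolding F_eq
      using finite_measure_Union[of "covered \<inter> {\<omega> \<in> space M. W \<omega> \<le> q}" ?Under] by force
  qed
  have T0: "0 \<le> T" by (simp add: T_def)
  have "\<bar>prob covered - (1 - \<alpha>)\<bar> \<le> L * (c + 2 * sqrt 2 * a) + 2 * T"
    using over under cov_split F_split Fq T0 measure_nonneg[of M ?Over] measure_nonneg[of M ?Under]
    by linarith
  also have "\<dots> = 2 * L / (c\<^sub>f * real n) + 2 * sqrt 2 * L * D / (c\<^sub>f * sqrt (real n))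
      + 8 * D\<^sup>2 / (real n * c\<^sub>f\<^sup>2 * e\<^sup>2)"
    by (simp add: T_def a_def c_def algebra_simps)
  finally show ?thesis .
qed

end

section \<open>Scores driven by independent innovations\<close>

locale causal_scores = prob_space M for M :: "'w measure" +
  fixes S :: "'e measure" and \<epsilon> :: "int \<Rightarrow> 'w \<Rightarrow> 'e" and \<epsilon>' :: "'w \<Rightarrow> 'e"
    and H :: "(nat \<Rightarrow> 'e) \<Rightarrow> real" and V :: "int \<Rightarrow> 'w \<Rightarrow> real"
  assumes indep: "indep_vars (\<lambda>_. S) (case_option \<epsilon>' \<epsilon>) UNIV"
    and ident: "\<And>t. distr M S (\<epsilon> t) = distr M S (\<epsilon> 0)"
    and ident': "distr M S \<epsilon>' = distr M S (\<epsilon> 0)"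
    and H: "H \<in> (\<Pi>\<^sub>M j\<in>UNIV. S) \<rightarrow>\<^sub>M borel"
    and V_eq: "\<And>t \<omega>. \<omega> \<in> space M \<Longrightarrow> V t \<omega> = H (past \<epsilon> t \<omega>)"
begin

definition law :: "'e measure" where "law = distr M S (\<epsilon> 0)"

definition past_law :: "(nat \<Rightarrow> 'e) measure" where "past_law = (\<Pi>\<^sub>M j\<in>UNIV. law)"

lemma rv_option: "random_variable S (case_option \<epsilon>' \<epsilon> i)"
  using indep unfolding indep_vars_def by blast

lemma measurable_innovation [measurable]: "random_variable S (\<epsilon> t)" "random_variable S \<epsilon>'"
  using rv_option[of "Some t"] rv_option[of None] by simp_all

lemma prob_space_law: "prob_space law"
  unfolding law_def by (intro prob_space_distr measurable_innovation)

sublocale iid_sequence law past_law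
proof -
  interpret law: prob_space law by (rule prob_space_law)
  show "iid_sequence law past_law"
    by unfold_locales (simp add: past_law_def)
qed

lemma sets_law [measurable_cong]: "sets law = sets S"
  by (simp add: law_def)

lemma sets_past_law: "sets past_law = sets (\<Pi>\<^sub>M j\<in>UNIV. S)"
  unfolding past_law_def by (intro sets_PiM_cong refl sets_law)

lemma measurable_H [measurable]: "H \<in> borel_measurable past_law"
  using H by (simp add: measurable_cong_sets[OF sets_past_law refl])

lemma measurable_past_of:
  assumes "\<And>j. j \<le> t \<Longrightarrow> \<epsilon> j \<in> A \<rightarrow>\<^sub>M S"
  shows "past \<epsilon> t \<in> A \<rightarrow>\<^sub>M past_law"
proof -
  have "past \<epsilon> t \<in> A \<rightarrow>\<^sub>M (\<Pi>\<^sub>M j\<in>UNIV. S)"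
    unfolding past_def[abs_def]
    by (rule measurable_PiM_single') (auto intro: assms measurable_space[OF assms])
  then show ?thesis by (simp add: measurable_cong_sets[OF refl sets_past_law])
qed

lemma measurable_past [measurable]: "past \<epsilon> t \<in> M \<rightarrow>\<^sub>M past_law"
  by (rule measurable_past_of) simp

lemma measurable_V_of:
  assumes "space A = space M" "\<And>j. j \<le> t \<Longrightarrow> \<epsilon> j \<in> A \<rightarrow>\<^sub>M S"
  shows "V t \<in> borel_measurable A"
proof -
  have "(\<lambda>\<omega>. H (past \<epsilon> t \<omega>)) \<in> borel_measurable A"
    using measurable_compose[OF measurable_past_of[OF assms(2)] measurable_H] by simp
  then show ?thesis
    using assms(1) by (subst measurable_cong[where g="\<lambda>\<omega>. H (past \<epsilon> t \<omega>)"]) (auto simp: V_eq)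
qed

lemma measurable_V [measurable]: "V t \<in> borel_measurable M"
  by (rule measurable_V_of) simp_all

lemma distr_innovations:
  "distr M (\<Pi>\<^sub>M i\<in>UNIV. S) (\<lambda>\<omega> i. case_option \<epsilon>' \<epsilon> i \<omega>) = (\<Pi>\<^sub>M i\<in>(UNIV :: int option set). law)"
proof -
  have "distr M S (case_option \<epsilon>' \<epsilon> i) = law" for i
    unfolding law_def using ident ident' by (cases i) auto
  moreover have "distr M (\<Pi>\<^sub>M i\<in>UNIV. S) (\<lambda>\<omega>. \<lambda>i\<in>UNIV. case_option \<epsilon>' \<epsilon> i \<omega>)
      = (\<Pi>\<^sub>M i\<in>UNIV. distr M S (case_option \<epsilon>' \<epsilon> i))"
    by (rule iffD1[OF indep_vars_iff_distr_eq_PiM indep]) (auto intro: rv_option)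
  ultimately show ?thesis by (simp only: restrict_UNIV)
qed

text \<open>Reading the family of all innovations along the injection \<open>l \<mapsto> t - l\<close> gives an iid sequence whatever \<open>t\<close>
is. The stationarity of the scores (\<open>distr_V\<close>) has this as its source.\<close>

lemma distr_past: "distr M past_law (past \<epsilon> t) = past_law"
proof -
  let ?E = "\<lambda>\<omega> i. case_option \<epsilon>' \<epsilon> i \<omega>" and ?r = "\<lambda>x l. x (Some (t - int l))"
  have E: "?E \<in> M \<rightarrow>\<^sub>M (\<Pi>\<^sub>M i\<in>UNIV. S)"
    by (rule measurable_PiM_single') (auto intro: rv_option measurable_space[OF rv_option])
  have sets_eq: "sets (\<Pi>\<^sub>M i\<in>(UNIV :: int option set). law) = sets (\<Pi>\<^sub>M i\<in>(UNIV :: int option set). S)"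
    by (intro sets_PiM_cong refl sets_law)
  have r: "?r \<in> (\<Pi>\<^sub>M i\<in>UNIV. law) \<rightarrow>\<^sub>M past_law"
    unfolding past_law_def by (rule measurable_PiM_single') (auto simp: space_PiM)
  then have r': "?r \<in> (\<Pi>\<^sub>M i\<in>UNIV. S) \<rightarrow>\<^sub>M past_law"
    by (simp add: measurable_cong_sets[OF sets_eq refl])
  have "distr M past_law (past \<epsilon> t) = distr M past_law (?r \<circ> ?E)"
    by (rule arg_cong[where f="distr M past_law"]) (simp add: past_def fun_eq_iff)
  also have "\<dots> = distr (distr M (\<Pi>\<^sub>M i\<in>UNIV. S) ?E) past_law ?r"
    by (rule distr_distr[OF r' E, symmetric])
  also have "\<dots> = distr (\<Pi>\<^sub>M i\<in>UNIV. law) past_law ?r"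
    by (simp only: distr_innovations)
  also have "\<dots> = past_law"
    using distr_PiM_reindex[of UNIV "\<lambda>_. law" "\<lambda>l. Some (t - int l)" UNIV] prob_space_law
    by (simp add: past_law_def restrict_UNIV inj_on_def)
  finally show ?thesis .
qed

text \<open>With \<open>past_coupled\<close> below, this turns the coupled pair of scores into a function on the product space,
where the copy of the innovation is an independent last argument.\<close>

lemma distr_past_copy:
  "distr M (past_law \<Otimes>\<^sub>M law) (\<lambda>\<omega>. (past \<epsilon> t \<omega>, \<epsilon>' \<omega>)) = past_law \<Otimes>\<^sub>M law"
proof -
  let ?X = "case_option \<epsilon>' \<epsilon>" and ?Pi = "\<Pi>\<^sub>M j\<in>(UNIV :: nat set). S"
  let ?C = "\<lambda>\<omega> (l :: nat). \<epsilon>' \<omega>" and ?h = "\<lambda>(x :: nat \<Rightarrow> 'e, z :: nat \<Rightarrow> 'e). (x, z 0)"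
  \<comment> \<open>As \<open>indep_var\<close> relates variables with values in one type, the copy is carried as the
    constant sequence \<open>?C\<close> and projected back by \<open>?h\<close>.\<close>
  have "indep_var (PiM (range Some) (\<lambda>_. S)) (\<lambda>\<omega>. \<lambda>i\<in>range Some. ?X i \<omega>)
      (PiM {None} (\<lambda>_. S)) (\<lambda>\<omega>. \<lambda>i\<in>{None}. ?X i \<omega>)"
    by (rule indep_var_restrict[OF indep]) auto
  then have "indep_var ?Pi ((\<lambda>x l. x (Some (t - int l))) \<circ> (\<lambda>\<omega>. \<lambda>i\<in>range Some. ?X i \<omega>))
      ?Pi ((\<lambda>x l. x None) \<circ> (\<lambda>\<omega>. \<lambda>i\<in>{None}. ?X i \<omega>))"
  proof (rule indep_var_compose)
    show "(\<lambda>x l. x (Some (t - int l))) \<in> PiM (range Some) (\<lambda>_. S) \<rightarrow>\<^sub>M ?Pi"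
      by (rule measurable_PiM_single') (auto simp: space_PiM)
    show "(\<lambda>x l. x None) \<in> PiM {None} (\<lambda>_. S) \<rightarrow>\<^sub>M ?Pi"
      by (rule measurable_PiM_single') (auto simp: space_PiM)
  qed
  also have "(\<lambda>x l. x (Some (t - int l))) \<circ> (\<lambda>\<omega>. \<lambda>i\<in>range Some. ?X i \<omega>) = past \<epsilon> t"
    by (auto simp: fun_eq_iff past_def)
  also have "(\<lambda>x l. x None) \<circ> (\<lambda>\<omega>. \<lambda>i\<in>{None}. ?X i \<omega>) = ?C"
    by (auto simp: fun_eq_iff)
  finally have joint: "distr M ?Pi (past \<epsilon> t) \<Otimes>\<^sub>M distr M ?Pi ?C
      = distr M (?Pi \<Otimes>\<^sub>M ?Pi) (\<lambda>\<omega>. (past \<epsilon> t \<omega>, ?C \<omega>))"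
    by (simp add: indep_var_distribution_eq)
  have past_Pi: "distr M ?Pi (past \<epsilon> t) = past_law"
    using distr_past by (subst distr_cong[OF refl sets_past_law[symmetric] refl]) simp_all
  have past_meas: "past \<epsilon> t \<in> M \<rightarrow>\<^sub>M ?Pi"
    using measurable_past by (simp add: measurable_cong_sets[OF refl sets_past_law])
  have C: "?C \<in> M \<rightarrow>\<^sub>M ?Pi"
    by (rule measurable_PiM_single') (auto intro: measurable_space[OF measurable_innovation(2)])
  have id: "(\<lambda>x. x) \<in> ?Pi \<rightarrow>\<^sub>M past_law"
    by (simp add: measurable_cong_sets[OF refl sets_past_law])
  have proj: "(\<lambda>z. z 0) \<in> ?Pi \<rightarrow>\<^sub>M law"
    by (simp add: measurable_cong_sets[OF refl sets_law])
  have h: "?h \<in> ?Pi \<Otimes>\<^sub>M ?Pi \<rightarrow>\<^sub>M past_law \<Otimes>\<^sub>M law"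
    unfolding case_prod_unfold
    by (intro measurable_Pair measurable_compose[OF measurable_fst id]
        measurable_compose[OF measurable_snd proj])
  have "distr (distr M ?Pi ?C) law (\<lambda>z. z 0) = distr M law ((\<lambda>z. z 0) \<circ> ?C)"
    by (rule distr_distr[OF proj C])
  also have "\<dots> = distr M S \<epsilon>'"
    by (intro distr_cong) (simp_all add: sets_law)
  finally have copy: "distr (distr M ?Pi ?C) law (\<lambda>z. z 0) = law"
    by (simp add: ident' law_def)
  have "past_law \<Otimes>\<^sub>M law
      = distr past_law past_law (\<lambda>x. x) \<Otimes>\<^sub>M distr (distr M ?Pi ?C) law (\<lambda>z. z 0)"
    by (simp only: copy distr_id)
  also have "\<dots> = distr (past_law \<Otimes>\<^sub>M distr M ?Pi ?C) (past_law \<Otimes>\<^sub>M law) ?h"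
  proof (rule pair_measure_distr)
    show "(\<lambda>z. z 0) \<in> distr M ?Pi ?C \<rightarrow>\<^sub>M law" using proj by simp
    show "sigma_finite_measure (distr (distr M ?Pi ?C) law (\<lambda>z. z 0))"
      unfolding copy by (rule Q.sigma_finite_measure_axioms)
  qed simp
  also have "\<dots> = distr (distr M (?Pi \<Otimes>\<^sub>M ?Pi) (\<lambda>\<omega>. (past \<epsilon> t \<omega>, ?C \<omega>))) (past_law \<Otimes>\<^sub>M law) ?h"
    using joint by (simp only: past_Pi)
  also have "\<dots> = distr M (past_law \<Otimes>\<^sub>M law) (?h \<circ> (\<lambda>\<omega>. (past \<epsilon> t \<omega>, ?C \<omega>)))"
    by (rule distr_distr[OF h measurable_Pair[OF past_meas C]])
  also have "?h \<circ> (\<lambda>\<omega>. (past \<epsilon> t \<omega>, ?C \<omega>)) = (\<lambda>\<omega>. (past \<epsilon> t \<omega>, \<epsilon>' \<omega>))"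
    by (simp add: fun_eq_iff)
  finally show ?thesis ..
qed

lemma distr_V: "distr M borel (V t) = distr past_law borel H"
proof -
  have "distr M borel (V t) = distr M borel (H \<circ> past \<epsilon> t)"
    by (intro distr_cong refl) (simp add: V_eq)
  also have "\<dots> = distr (distr M past_law (past \<epsilon> t)) borel H"
    by (rule distr_distr[symmetric]) measurable
  finally show ?thesis by (simp only: distr_past)
qed

lemma past_coupled: "past (\<epsilon>(0 := \<epsilon>')) (int k) \<omega> = (past \<epsilon> (int k) \<omega>)(k := \<epsilon>' \<omega>)"
  by (auto simp: past_def fun_eq_iff)

text \<open>The coefficient is a supremum over thresholds; the squared norm at the threshold \<open>v\<close> becomes, under the
joint law of the past and the copy, the mean squared effect of resampling one coordinate.\<close>

lemma indicator_dependence_bound: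
  fixes v :: real
  defines "A \<equiv> {x \<in> space past_law. H x \<le> v}"
  defines "\<theta> \<equiv> \<lambda>k. indicator_dependence M (V (int k)) (\<lambda>\<omega>. H (past (\<epsilon>(0 := \<epsilon>')) (int k) \<omega>))"
  shows "(\<integral>x. (\<integral>y. (indicator A x - indicator A (x(k := y)))\<^sup>2 \<partial>law) \<partial>past_law) \<le> (\<theta> k)\<^sup>2"
    and "0 \<le> \<theta> k"
proof -
  let ?V' = "\<lambda>\<omega>. H (past (\<epsilon>(0 := \<epsilon>')) (int k) \<omega>)"
  have V'[measurable]: "?V' \<in> borel_measurable M"
    unfolding past_coupled by measurable
  define l where "l v = L2_norm M (\<lambda>\<omega>. indicator {..v} (V (int k) \<omega>) - indicator {..v} (?V' \<omega>))" for v
  have l_le: "l v \<le> 1" for v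
  proof -
    have "(\<integral>\<omega>. \<bar>indicator {..v} (V (int k) \<omega>) - indicator {..v} (?V' \<omega>)\<bar>\<^sup>2 \<partial>M) \<le> (\<integral>\<omega>. (1::real) \<partial>M)"
      by (intro integral_mono integrable_const integrable_const_bound[where B=1] AE_I2)
        (auto simp: indicator_def)
    then show ?thesis by (simp add: l_def L2_norm_def prob_space)
  qed
  have \<theta>_eq: "\<theta> k = (SUP v. l v)"
    by (simp add: \<theta>_def indicator_dependence_def l_def)
  have "bdd_above (range l)" using l_le by (auto intro!: bdd_aboveI[of _ 1])
  then have l_\<theta>: "l v \<le> \<theta> k" unfolding \<theta>_eq by (rule cSUP_upper2) auto
  have l0: "0 \<le> l v" by (simp add: l_def L2_norm_def)
  then show "0 \<le> \<theta> k" using l_\<theta> by simp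
  have A[measurable]: "A \<in> sets past_law" unfolding A_def by measurable
  let ?g = "\<lambda>(x, y). (indicator A x - indicator A (x(k := y)))\<^sup>2 :: real"
  have g: "?g \<in> borel_measurable (past_law \<Otimes>\<^sub>M law)" by measurable
  have "(\<integral>x. (\<integral>y. (indicator A x - indicator A (x(k := y)))\<^sup>2 \<partial>law) \<partial>past_law)
      = (\<integral>z. ?g z \<partial>(past_law \<Otimes>\<^sub>M law))"
    by (rule PQ.integral_fst, rule PQ.integrable_const_bound[where B=1, OF AE_I2 g])
      (auto simp: indicator_def)
  also have "\<dots> = (\<integral>z. ?g z \<partial>distr M (past_law \<Otimes>\<^sub>M law) (\<lambda>\<omega>. (past \<epsilon> (int k) \<omega>, \<epsilon>' \<omega>)))"
    by (simp only: distr_past_copy)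
  also have "\<dots> = (\<integral>\<omega>. ?g (past \<epsilon> (int k) \<omega>, \<epsilon>' \<omega>) \<partial>M)"
    by (rule integral_distr[OF _ g]) measurable
  also have "\<dots> = (\<integral>\<omega>. \<bar>indicator {..v} (V (int k) \<omega>) - indicator {..v} (?V' \<omega>)\<bar>\<^sup>2 \<partial>M)"
  proof (intro Bochner_Integration.integral_cong refl)
    fix \<omega> assume \<omega>: "\<omega> \<in> space M"
    have sp: "past \<epsilon> (int k) \<omega> \<in> space past_law" "\<epsilon>' \<omega> \<in> space law"
      using measurable_space[OF measurable_past \<omega>] measurable_space[OF measurable_innovation(2) \<omega>]
      by (auto simp: law_def)
    show "?g (past \<epsilon> (int k) \<omega>, \<epsilon>' \<omega>) = \<bar>indicator {..v} (V (int k) \<omega>) - indicator {..v} (?V' \<omega>)\<bar>\<^sup>2"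
      using sp by (simp add: V_eq[OF \<omega>] past_coupled A_def indicator_def)
  qed
  also have "\<dots> = (l v)\<^sup>2" by (simp add: l_def L2_norm_def)
  also have "\<dots> \<le> (\<theta> k)\<^sup>2" using l_\<theta> l0 by (intro power_mono)
  finally show "(\<integral>x. (\<integral>y. (indicator A x - indicator A (x(k := y)))\<^sup>2 \<partial>law) \<partial>past_law) \<le> (\<theta> k)\<^sup>2" .
qed

text \<open>All scores \<open>V 1, \<dots>, V n\<close> are functions of the past of time \<open>n\<close>, namely \<open>H\<close> at its shifts by
\<open>d = n - i\<close>.\<close>

proposition count_second_moment:
  fixes v :: real
  defines "\<theta> \<equiv> \<lambda>k. indicator_dependence M (V (int k)) (\<lambda>\<omega>. H (past (\<epsilon>(0 := \<epsilon>')) (int k) \<omega>))"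
  assumes \<theta>: "summable \<theta>"
  shows "expectation (\<lambda>\<omega>. ((\<Sum>i\<in>{1..int n}. indicator {..v} (V i \<omega>))
      - real n * cdf (distr M borel (V 0)) v)\<^sup>2) \<le> real n * (\<Sum>k. \<theta> k)\<^sup>2"
proof -
  define A where "A = {x \<in> space past_law. H x \<le> v}"
  have A[measurable]: "A \<in> sets past_law" unfolding A_def by measurable
  have prob_A: "P.prob A = cdf (distr M borel (V 0)) v"
    unfolding distr_V by (simp add: cdf_def measure_distr A_def vimage_def Int_def conj_commute)
  let ?g = "\<lambda>x. ((\<Sum>d<n. indicator A (\<lambda>l. x (l + d))) - real n * P.prob A)\<^sup>2"
  have "(\<integral>\<omega>. ((\<Sum>i\<in>{1..int n}. indicator {..v} (V i \<omega>)) - real n * P.prob A)\<^sup>2 \<partial>M)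
      = (\<integral>\<omega>. ?g (past \<epsilon> (int n) \<omega>) \<partial>M)"
  proof (intro Bochner_Integration.integral_cong refl)
    fix \<omega> assume \<omega>: "\<omega> \<in> space M"
    have "(\<Sum>i\<in>{1..int n}. indicator {..v} (V i \<omega>)) = (\<Sum>d<n. indicator {..v} (V (int n - int d) \<omega>) :: real)"
      by (rule sum.reindex_bij_witness[of _ "\<lambda>d. int n - int d" "\<lambda>i. nat (int n - i)"]) auto
    also have "\<dots> = (\<Sum>d<n. indicator A (\<lambda>l. past \<epsilon> (int n) \<omega> (l + d)))"
    proof (intro sum.cong refl)
      fix d
      have eq: "(\<lambda>l. past \<epsilon> (int n) \<omega> (l + d)) = past \<epsilon> (int n - int d) \<omega>"
        by (simp add: past_def fun_eq_iff algebra_simps)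
      show "indicator {..v} (V (int n - int d) \<omega>)
          = (indicator A (\<lambda>l. past \<epsilon> (int n) \<omega> (l + d)) :: real)"
        unfolding eq using measurable_space[OF measurable_past \<omega>]
        by (simp add: V_eq[OF \<omega>] A_def indicator_def)
    qed
    finally show "((\<Sum>i\<in>{1..int n}. indicator {..v} (V i \<omega>)) - real n * P.prob A)\<^sup>2
        = ?g (past \<epsilon> (int n) \<omega>)"
      by simp
  qed
  also have "\<dots> = (\<integral>x. ?g x \<partial>distr M past_law (past \<epsilon> (int n)))"
    by (rule integral_distr[symmetric]) measurable
  also have "\<dots> \<le> real n * (\<Sum>k. \<theta> k)\<^sup>2"
    unfolding distr_past
    using indicator_dependence_bound(1)[where v=v] indicator_dependence_bound(2) \<theta> A unfolding \<theta>_def A_def[symmetric]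
    by (intro variance_shift_sum_le) auto
  finally show ?thesis by (simp only: prob_A)
qed

lemma subalgebra_innovation_sigma: "subalgebra M (innovation_sigma M S \<epsilon> t)"
  and measurable_innovation_sigma: "j \<le> t \<Longrightarrow> \<epsilon> j \<in> innovation_sigma M S \<epsilon> t \<rightarrow>\<^sub>M S"
  and space_innovation_sigma: "space (innovation_sigma M S \<epsilon> t) = space M"
proof -
  let ?G = "\<Union>j\<in>{..t}. {\<epsilon> j -` A \<inter> space M | A. A \<in> sets S}"
  have G: "?G \<subseteq> sets M"
    using measurable_innovation(1) by (auto intro: measurable_sets)
  then have G_Pow: "?G \<subseteq> Pow (space M)" using sets.sets_into_space by blast
  have sets_eq: "sets (innovation_sigma M S \<epsilon> t) = sigma_sets (space M) ?G"
    unfolding innovation_sigma_def using G_Pow by (rule sets_measure_of)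
  show sp: "space (innovation_sigma M S \<epsilon> t) = space M"
    unfolding innovation_sigma_def using G_Pow by (rule space_measure_of)
  show "subalgebra M (innovation_sigma M S \<epsilon> t)"
    unfolding subalgebra_def sp sets_eq using sets.sigma_sets_subset[OF G] by simp
  show "\<epsilon> j \<in> innovation_sigma M S \<epsilon> t \<rightarrow>\<^sub>M S" if "j \<le> t"
  proof (rule measurableI)
    fix A assume "A \<in> sets S"
    then have "\<epsilon> j -` A \<inter> space M \<in> ?G" using that by auto
    then show "\<epsilon> j -` A \<inter> space (innovation_sigma M S \<epsilon> t) \<in> sets (innovation_sigma M S \<epsilon> t)"
      unfolding sp sets_eq by (rule sigma_sets.Basic)
  qed (simp add: sp measurable_space[OF measurable_innovation(1)])
qed

lemma measurable_V_innovation_sigma: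
  "i \<le> t \<Longrightarrow> V i \<in> borel_measurable (innovation_sigma M S \<epsilon> t)"
  by (rule measurable_V_of[OF space_innovation_sigma measurable_innovation_sigma]) auto

end

section \<open>Consequences of the density hypotheses\<close>

text \<open>The conditional density is used only in this integrated form, for events of the past and fixed
intervals; the grid estimate never evaluates the kernel at a random endpoint.\<close>

lemma (in prob_space) regular_cond_distr_density_bound:
  fixes W :: "'a \<Rightarrow> real"
  assumes sub: "subalgebra M \<F>" and W[measurable]: "W \<in> borel_measurable M"
    and K: "regular_cond_distr M \<F> borel W K"
    and dens: "AE \<omega> in M. \<exists>p\<in>borel_measurable borel. (\<forall>v. 0 \<le> p v) \<and>
      K \<omega> = density lborel (\<lambda>v. ennreal (p v)) \<and> (\<forall>v\<in>{a..b}. p v \<le> L)"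
    and "L \<ge> 0" "a \<le> x" "x \<le> y" "y \<le> b" and B: "B \<in> sets \<F>"
  shows "prob (B \<inter> {\<omega> \<in> space M. x \<le> W \<omega> \<and> W \<omega> \<le> y}) \<le> L * (y - x) * prob B"
proof -
  interpret finite_measure_subalgebra M \<F>
    using sub by unfold_locales
  have B_M[measurable]: "B \<in> events" using B sub by (auto simp: subalgebra_def)
  let ?I = "W -` {x..y} \<inter> space M"
  have I_event: "?I \<in> events" by measurable
  have le: "measure (K \<omega>) {x..y} \<le> L * (y - x)"
    if p: "p \<in> borel_measurable borel" "K \<omega> = density lborel (\<lambda>v. ennreal (p v))"
      "\<forall>v\<in>{a..b}. p v \<le> L" for \<omega> p
  proof -
    have "emeasure (K \<omega>) {x..y} = (\<integral>\<^sup>+v. ennreal (p v) * indicator {x..y} v \<partial>lborel)"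
      using p(1) unfolding p(2) by (subst emeasure_density) auto
    also have "\<dots> \<le> (\<integral>\<^sup>+v. ennreal L * indicator {x..y} v \<partial>lborel)"
      using p(3) assms by (intro nn_integral_mono) (auto simp: indicator_def intro!: ennreal_leI)
    also have "\<dots> = ennreal (L * (y - x))"
      using assms by (simp add: nn_integral_cmult ennreal_mult)
    finally show ?thesis
      using assms by (simp add: measure_def enn2real_leI)
  qed
  have cond: "AE \<omega> in M. real_cond_exp M \<F> (indicator ?I) \<omega> \<le> L * (y - x)"
  proof -
    have "AE \<omega> in M. measure (K \<omega>) {x..y} = real_cond_exp M \<F> (indicator ?I) \<omega>"
      using K by (simp add: regular_cond_distr_def)
    then show ?thesis using dens
    proof eventually_elim
      case (elim \<omega>)
      then obtain p where "p \<in> borel_measurable borel" "K \<omega> = density lborel (\<lambda>v. ennreal (p v))"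
        "\<forall>v\<in>{a..b}. p v \<le> L" by blast
      from le[OF this] elim(1) show ?case by simp
    qed
  qed
  have int_I: "integrable M (indicator ?I :: 'a \<Rightarrow> real)"
    using I_event emeasure_finite by (intro integrable_real_indicator) (simp_all add: less_top[symmetric])
  have "prob (B \<inter> {\<omega> \<in> space M. x \<le> W \<omega> \<and> W \<omega> \<le> y}) = prob (B \<inter> ?I)"
    by (rule arg_cong[where f=prob]) auto
  also have "\<dots> = (\<integral>\<omega>\<in>B. indicator ?I \<omega> \<partial>M)"
    using B_M I_event
    by (simp add: set_lebesgue_integral_def indicator_inter_arith[symmetric])
  also have "\<dots> = (\<integral>\<omega>\<in>B. real_cond_exp M \<F> (indicator ?I) \<omega> \<partial>M)"
    by (rule real_cond_exp_intA[OF int_I B])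
  also have "\<dots> \<le> (\<integral>\<omega>\<in>B. L * (y - x) \<partial>M)"
    unfolding set_lebesgue_integral_def
  proof (rule integral_mono_AE)
    show "integrable M (\<lambda>\<omega>. indicator B \<omega> *\<^sub>R real_cond_exp M \<F> (indicator ?I) \<omega>)"
      using real_cond_exp_int(1)[OF int_I] by (intro integrable_mult_indicator B_M)
    show "integrable M (\<lambda>\<omega>. indicator B \<omega> *\<^sub>R (L * (y - x)))"
      by (intro integrable_mult_indicator B_M integrable_const)
    show "AE \<omega> in M. indicator B \<omega> *\<^sub>R real_cond_exp M \<F> (indicator ?I) \<omega>
        \<le> indicator B \<omega> *\<^sub>R (L * (y - x))"
      using cond by eventually_elim (auto simp: indicator_def)
  qed
  also have "\<dots> = L * (y - x) * prob B"
    by (simp add: set_lebesgue_integral_def mult.commute)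
  finally show ?thesis .
qed

lemma (in prob_space) cdf_increment_ge:
  fixes f :: "real \<Rightarrow> real"
  assumes W: "distributed M lborel W (\<lambda>v. ennreal (f v))"
    and f: "\<And>v. v \<in> {a..b} \<Longrightarrow> c \<le> f v" and "c \<ge> 0" "a \<le> x" "x \<le> y" "y \<le> b"
  shows "c * (y - x) \<le> cdf (distr M borel W) y - cdf (distr M borel W) x"
proof -
  have [measurable]: "W \<in> borel_measurable M"
    using distributed_measurable[OF W] by simp
  have "ennreal (c * (y - x)) = (\<integral>\<^sup>+v. ennreal c * indicator {x<..y} v \<partial>lborel)"
    using assms by (simp add: nn_integral_cmult ennreal_mult)
  also have "\<dots> \<le> (\<integral>\<^sup>+v. ennreal (f v) * indicator {x<..y} v \<partial>lborel)"
    using assms by (intro nn_integral_mono) (auto simp: indicator_def intro!: ennreal_leI)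
  also have "\<dots> = emeasure M (W -` {x<..y} \<inter> space M)"
    using distributed_emeasure[OF W, of "{x<..y}"] by simp
  also have "\<dots> = ennreal (prob (W -` {x<..y} \<inter> space M))"
    by (rule emeasure_eq_measure)
  finally have "c * (y - x) \<le> prob (W -` {x<..y} \<inter> space M)"
    by (simp add: ennreal_le_iff)
  also have "W -` {x<..y} \<inter> space M = {\<omega> \<in> space M. W \<omega> \<le> y} - {\<omega> \<in> space M. W \<omega> \<le> x}"
    by auto
  also have "prob \<dots> = cdf (distr M borel W) y - cdf (distr M borel W) x"
    using \<open>x \<le> y\<close> by (subst finite_measure_Diff) (auto simp: cdf_distr_eq)
  finally show ?thesis .
qed

text \<open>The infimum is attained because the superlevel set is closed and bounded below, and it does not
overshoot because a continuous distribution function takes the value \<open>p\<close> somewhere.\<close>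

lemma (in prob_space) cdf_lower_quantile:
  assumes [measurable]: "W \<in> borel_measurable M"
    and cont: "continuous_on UNIV (cdf (distr M borel W))" and p: "0 < p" "p < 1"
  shows "cdf (distr M borel W) (lower_quantile (cdf (distr M borel W)) p) = p"
proof -
  interpret W: real_distribution "distr M borel W"
    by (intro real_distribution_distr) simp
  let ?F = "cdf (distr M borel W)" and ?A = "{v. cdf (distr M borel W) v \<ge> p}"
  obtain c where c: "?F c = p"
    using continuous_cdf_attains[OF assms] by blast
  obtain l where l: "?F l = p / 2"
    using continuous_cdf_attains[OF assms(1,2), of "p / 2"] p by auto
  have bdd: "bdd_below ?A"
  proof (rule bdd_belowI)
    fix v assume "v \<in> ?A"
    then have "?F l < ?F v" using l p by simp
    then show "l \<le> v" using W.cdf_nondecreasing[of v l] by (meson leI less_imp_le not_less)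
  qed
  have "closed ?A" using cont by (intro closed_Collect_le continuous_intros) auto
  then have "Inf ?A \<in> ?A" using bdd c by (intro closed_contains_Inf) auto
  moreover have "?F (Inf ?A) \<le> ?F c"
    using bdd c by (intro W.cdf_nondecreasing cInf_lower) auto
  ultimately show ?thesis using c by (simp add: lower_quantile_def)
qed

section \<open>Coverage of split conformal prediction sets\<close>

theorem theorem1:
  fixes M :: "'w measure" and S :: "'e measure"
    and \<epsilon> :: "int \<Rightarrow> 'w \<Rightarrow> 'e" and \<epsilon>' :: "'w \<Rightarrow> 'e"
    and G :: "(nat \<Rightarrow> 'e) \<Rightarrow> (real ^ 'd) \<times> real"
    and \<mu> :: "real ^ 'd \<Rightarrow> real"
    and X :: "int \<Rightarrow> 'w \<Rightarrow> real ^ 'd" and Y V :: "int \<Rightarrow> 'w \<Rightarrow> real"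
    and Vstar :: "nat \<Rightarrow> 'w \<Rightarrow> real"
    and F :: "real \<Rightarrow> real" and \<theta> :: "nat \<Rightarrow> real" and \<Theta> \<alpha> q :: real
    and coverage :: "int \<Rightarrow> real" and n :: nat
  assumes "prob_space M"
    and indep: "prob_space.indep_vars M (\<lambda>_. S) (case_option \<epsilon>' \<epsilon>) UNIV"
    and ident: "\<And>t. distr M S (\<epsilon> t) = distr M S (\<epsilon> 0)" "distr M S \<epsilon>' = distr M S (\<epsilon> 0)"
    and G: "G \<in> (\<Pi>\<^sub>M j\<in>UNIV. S) \<rightarrow>\<^sub>M borel"
    and \<mu>: "\<mu> \<in> borel \<rightarrow>\<^sub>M borel"
    and Z: "\<And>t \<omega>. \<omega> \<in> space M \<Longrightarrow> (X t \<omega>, Y t \<omega>) = G (past \<epsilon> t \<omega>)"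
    and V: "\<And>t \<omega>. V t \<omega> = \<bar>Y t \<omega> - \<mu> (X t \<omega>)\<bar>"
    and Vstar: "\<And>k \<omega>. Vstar k \<omega> = score \<mu> (G (past (\<epsilon>(0 := \<epsilon>')) (int k) \<omega>))"
    and F: "F = cdf (distr M borel (V 0))"
    and \<theta>: "\<And>k. \<theta> k = indicator_dependence M (V (int k)) (Vstar k)"
    and \<Theta>: "\<Theta> = (\<Sum>k. \<theta> k)"
    and \<alpha>: "0 < \<alpha>" "\<alpha> < 1" and n: "n \<ge> 1"
    and q: "q = lower_quantile F (1 - \<alpha>)"
    and coverage: "\<And>t. coverage t = measure M
      {\<omega> \<in> space M. Y t \<omega> \<in> conformal_set \<mu> (conformal_quantile \<alpha> n (\<lambda>i. V i \<omega>)) (X t \<omega>)}"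
    and F_cont: "continuous_on UNIV F"
    and \<Theta>_finite: "summable \<theta>"
  shows "(2 / real n + (2 * \<Theta>\<^sup>2 / real n) powr (1/3) < min \<alpha> (1 - \<alpha>) \<longrightarrow>
      (\<forall>t > int n. \<bar>coverage t - (1 - \<alpha>)\<bar>
        \<le> 2 / real n + 3 * (\<Theta>\<^sup>2 / (4 * real n)) powr (1/3)))
    \<and> (\<forall>(e::real) (c\<^sub>f::real) (L::real) (f::real \<Rightarrow> real).
      e > 0 \<and> c\<^sub>f > 0 \<and> L > 0 \<and>
      (\<forall>v. 0 \<le> f v) \<and> distributed M lborel (V 0) (\<lambda>v. ennreal (f v)) \<and>
      (\<forall>v\<in>{q - e..q + e}. c\<^sub>f \<le> f v) \<and>
      (\<forall>t. \<exists>K. regular_cond_distr M (innovation_sigma M S \<epsilon> (t - 1)) borel (V t) K \<and>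
        (AE \<omega> in M. \<exists>p\<in>borel_measurable borel. (\<forall>v. 0 \<le> p v) \<and>
           K \<omega> = density lborel (\<lambda>v. ennreal (p v)) \<and> (\<forall>v\<in>{q - e..q + e}. p v \<le> L))) \<and>
      2 / real n \<le> c\<^sub>f * e / 2 \<longrightarrow>
      (\<forall>t > int n. \<bar>coverage t - (1 - \<alpha>)\<bar>
        \<le> 2 * L / (c\<^sub>f * real n) + 2 * sqrt 2 * L * \<Theta> / (c\<^sub>f * sqrt (real n))
          + 8 * \<Theta>\<^sup>2 / (real n * c\<^sub>f\<^sup>2 * e\<^sup>2)))"
proof -
  interpret prob_space M by fact
  have score: "score \<mu> \<in> borel_measurable borel"
    unfolding score_def borel_prod[symmetric] using \<mu> by measurable
  interpret causal_scores M S \<epsilon> \<epsilon>' "\<lambda>x. score \<mu> (G x)" V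
  proof
    show "V t \<omega> = score \<mu> (G (past \<epsilon> t \<omega>))" if "\<omega> \<in> space M" for t \<omega>
      unfolding Z[OF that, symmetric] by (simp add: V score_def)
  qed (use indep ident measurable_compose[OF G score] in auto)
  have \<theta>_eq: "\<theta> = (\<lambda>k. indicator_dependence M (V (int k))
      (\<lambda>\<omega>. score \<mu> (G (past (\<epsilon>(0 := \<epsilon>')) (int k) \<omega>))))"
    by (simp add: fun_eq_iff \<theta> Vstar[abs_def])
  define N where "N m c \<omega> = (\<Sum>i\<in>{1..int m}. indicator {..c} (V i \<omega>) :: real)" for m c \<omega>
  have moment: "expectation (\<lambda>\<omega>. (N m c \<omega> - real m * F c)\<^sup>2) \<le> real m * \<Theta>\<^sup>2" for m c
    unfolding N_def F \<Theta> \<theta>_eq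
    by (rule count_second_moment) (use \<Theta>_finite in \<open>simp only: \<theta>_eq\<close>)
  \<comment> \<open>At the median one indicator has variance \<open>1 / 4\<close>, which the second-moment bound for a single score
    compares with \<open>\<Theta>\<^sup>2\<close>.\<close>
  have \<Theta>_pos: "\<Theta> > 0"
  proof -
    obtain c where c: "F c = 1 / 2"
      using continuous_cdf_attains[OF measurable_V[of 0], of "1 / 2"] F_cont F by auto
    have "(N 1 c \<omega> - real 1 * F c)\<^sup>2 = 1 / 4" for \<omega>
      by (cases "V 1 \<omega> \<le> c") (simp_all add: N_def c power2_eq_square)
    then have "expectation (\<lambda>\<omega>. (N 1 c \<omega> - real 1 * F c)\<^sup>2) = 1 / 4"
      by (simp only: lebesgue_integral_const prob_space scaleR_one)
    then have "\<Theta>\<^sup>2 \<ge> 1 / 4" using moment[of 1 c] by (simp only: of_nat_1 mult_1)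
    moreover have "\<Theta> \<ge> 0"
      unfolding \<Theta> using \<Theta>_finite indicator_dependence_bound(2) by (intro suminf_nonneg) (simp_all add: \<theta>_eq)
    ultimately show ?thesis by (cases "\<Theta> = 0") auto
  qed
  have Ft: "F = cdf (distr M borel (V t))" for t
    by (simp only: F distr_V)
  have split: "split_conformal M (V t) (N n) (\<lambda>\<omega>. conformal_quantile \<alpha> n (\<lambda>i. V i \<omega>)) F n
      (conformal_rank \<alpha> n) \<Theta> \<alpha>" for t
  proof
    show "N n c \<in> borel_measurable M" for c unfolding N_def[abs_def] by measurable
    show "\<bar>N n c \<omega>\<bar> \<le> real n" for c \<omega>
    proof -
      have "N n c \<omega> \<le> (\<Sum>i\<in>{1..int n}. 1)"
        unfolding N_def by (intro sum_mono) (auto simp: indicator_def)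
      moreover have "0 \<le> N n c \<omega>" unfolding N_def by (intro sum_nonneg) auto
      ultimately show ?thesis by simp
    qed
    show "conformal_quantile \<alpha> n (\<lambda>i. V i \<omega>) \<le> ereal c \<longleftrightarrow> real (conformal_rank \<alpha> n) \<le> N n c \<omega>" for c \<omega>
      unfolding N_def by (rule conformal_quantile_le_iff[OF \<alpha>])
  qed (use Ft F_cont moment n \<Theta>_pos \<alpha> conformal_rank_bounds[OF \<alpha>] in auto)
  have cov: "coverage t = prob (split_conformal.covered M (V t) (\<lambda>\<omega>. conformal_quantile \<alpha> n (\<lambda>i. V i \<omega>)))" for t
    unfolding coverage split_conformal.covered_def[OF split] mem_conformal_set_iff V[symmetric] ..
  have Fq: "F q = 1 - \<alpha>"
    unfolding q F using cdf_lower_quantile[OF measurable_V[of 0], of "1 - \<alpha>"] F_cont \<alpha> F by simp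
  show ?thesis
  proof (intro conjI impI allI)
    fix t assume "2 / real n + (2 * \<Theta>\<^sup>2 / real n) powr (1/3) < min \<alpha> (1 - \<alpha>)"
    then show "\<bar>coverage t - (1 - \<alpha>)\<bar> \<le> 2 / real n + 3 * (\<Theta>\<^sup>2 / (4 * real n)) powr (1/3)"
      unfolding cov by (rule split_conformal.coverage_continuous[OF split])
  next
    fix e c\<^sub>f L :: real and f :: "real \<Rightarrow> real" and t
    assume A: "e > 0 \<and> c\<^sub>f > 0 \<and> L > 0 \<and>
      (\<forall>v. 0 \<le> f v) \<and> distributed M lborel (V 0) (\<lambda>v. ennreal (f v)) \<and>
      (\<forall>v\<in>{q - e..q + e}. c\<^sub>f \<le> f v) \<and>
      (\<forall>t. \<exists>K. regular_cond_distr M (innovation_sigma M S \<epsilon> (t - 1)) borel (V t) K \<and>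
        (AE \<omega> in M. \<exists>p\<in>borel_measurable borel. (\<forall>v. 0 \<le> p v) \<and>
           K \<omega> = density lborel (\<lambda>v. ennreal (p v)) \<and> (\<forall>v\<in>{q - e..q + e}. p v \<le> L))) \<and>
      2 / real n \<le> c\<^sub>f * e / 2" and t: "int n < t"
    then obtain K where K: "regular_cond_distr M (innovation_sigma M S \<epsilon> (t - 1)) borel (V t) K"
      "AE \<omega> in M. \<exists>p\<in>borel_measurable borel. (\<forall>v. 0 \<le> p v) \<and>
         K \<omega> = density lborel (\<lambda>v. ennreal (p v)) \<and> (\<forall>v\<in>{q - e..q + e}. p v \<le> L)"
      by blast
    let ?\<F> = "innovation_sigma M S \<epsilon> (t - 1)"
    have V_meas: "V i \<in> borel_measurable ?\<F>" if "i \<in> {1..int n}" for i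
      using that t by (intro measurable_V_innovation_sigma) auto
    have N_meas: "N n c \<in> borel_measurable ?\<F>" for c
      unfolding N_def[abs_def]
      by (intro borel_measurable_sum measurable_compose[OF V_meas] borel_measurable_indicator) auto
    show "\<bar>coverage t - (1 - \<alpha>)\<bar>
        \<le> 2 * L / (c\<^sub>f * real n) + 2 * sqrt 2 * L * \<Theta> / (c\<^sub>f * sqrt (real n))
          + 8 * \<Theta>\<^sup>2 / (real n * c\<^sub>f\<^sup>2 * e\<^sup>2)"
      unfolding cov
    proof (rule split_conformal.coverage_density[OF split Fq, where \<F>="sets ?\<F>"])
      show "c\<^sub>f * (y - x) \<le> F y - F x" if "q - e \<le> x" "x \<le> y" "y \<le> q + e" for x y
        unfolding F using A that by (intro cdf_increment_ge[where f=f and a="q - e" and b="q + e"]) auto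
      show "sets ?\<F> \<subseteq> events" "space M \<in> sets ?\<F>"
        using subalgebra_innovation_sigma[of "t - 1"] sets.top[of ?\<F>] by (auto simp: subalgebra_def)
      show "{\<omega> \<in> space M. N n c \<omega> < real (conformal_rank \<alpha> n)} \<in> sets ?\<F>" for c
        using borel_measurable_less[OF N_meas[of c] borel_measurable_const[of "real (conformal_rank \<alpha> n)"]]
        by (simp add: space_innovation_sigma)
      show "{\<omega> \<in> space M. real (conformal_rank \<alpha> n) \<le> N n c \<omega>} \<in> sets ?\<F>" for c
        using borel_measurable_le[OF borel_measurable_const[of "real (conformal_rank \<alpha> n)"] N_meas[of c]]
        by (simp add: space_innovation_sigma)
      show "prob (B \<inter> {\<omega> \<in> space M. x \<le> V t \<omega> \<and> V t \<omega> \<le> y}) \<le> L * (y - x) * prob B"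
        if "B \<in> sets ?\<F>" "q - e \<le> x" "x \<le> y" "y \<le> q + e" for B x y
        using A that
        by (intro regular_cond_distr_density_bound[OF subalgebra_innovation_sigma measurable_V K]) auto
    qed (use A in auto)
  qed
qed

end
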